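(* Let $G$ be a finite abelian $p$-group, or more generally a finite abelian group with $\mathsf{D}(G)=\mathsf{D}^{\ast}(G)$, and let $k\in \mathbb{N}_0$. If $\mathsf{r}(G)\ge \exp(G)+1-k$, then \[\mathsf{SD}_k(G)= \mathsf{D}^{\ast}(G).\]
   Context: $\mathbb{N}_0$ denotes the non-negative integers; groups are written additively. For a finite abelian group $G\cong C_{n_1}\oplus\dots\oplus C_{n_r}$ with $1<n_1\mid\dots\mid n_r$ (where $C_n$ is cyclic of order $n$), $\mathsf{r}(G)=r$ is the rank, $\exp(G)=n_r$ is the exponent ($\exp(G)=1$ if $G$ is trivial), and $\mathsf{D}^{\ast}(G)=1+\sum_{i=1}^r(n_i-1)$. A $p$-group is a group whose exponent is a prime power. A sequence over $G$ is a finite multiset $S$ of elements of $G$; its length $|S|$ is the number of terms counted with multiplicity, and $\mathsf{v}_g(S)$ is the multiplicity of $g$ in $S$. A minimal zero-sum sequence is a non-empty sequence whose terms sum to $0$ and none of whose proper non-empty subsequences has sum $0$. The Davenport constant $\mathsf{D}(G)$ is the maximal length of a minimal zero-sum sequence over $G$ (equivalently, the smallest integer $\ell$ such that every sequence over $G$ of length at least $\ell$ has a non-empty subsequence with sum $0$). The cumulated multiplicity of $S$ is $\mathrm{cm}(S)=\sum_{g\in G}\max\{0,\mathsf{v}_g(S)-1\}$. The $k$-th Strong Davenport constant $\mathsf{SD}_k(G)$ is the maximal length of a minimal zero-sum sequence $S$ over $G$ with $\mathrm{cm}(S)\le k$. *)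

theory Defs
  imports "HOL-Algebra.Algebra" "HOL-Library.Multiset"
begin

text \<open>
  An abelian group is a \<^locale>\<open>comm_group\<close> and hence written multiplicatively:
  the zero of the additive notation is \<open>\<one>\<close> and the sum of a sequence is a finite product.
\<close>

section \<open>Invariants of finite abelian groups\<close>

text \<open>
  \<open>is_invariant_factors G [n\<^sub>1, \<dots>, n\<^sub>r]\<close> says that \<open>G\<close> is isomorphic to
  the direct sum of the cyclic groups of orders \<open>n\<^sub>1, \<dots>, n\<^sub>r\<close>, where
  \<open>1 < n\<^sub>1\<close> and \<open>n\<^sub>i\<close> divides \<open>n\<^sub>i\<^sub>+\<^sub>1\<close>.
\<close>
definition is_invariant_factors :: "('a, 'b) monoid_scheme \<Rightarrow> nat list \<Rightarrow> bool" where
  "is_invariant_factors G ns \<longleftrightarrow>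
     (\<forall>n\<in>set ns. 1 < n) \<and>
     (\<forall>i. Suc i < length ns \<longrightarrow> ns ! i dvd ns ! Suc i) \<and>
     G \<cong> product_group {..<length ns} (\<lambda>i. integer_mod_group (ns ! i))"

text \<open>
  For a finite abelian group, the structure theorem states that exactly one list qualifies,
  so the choice below is no choice at all.
\<close>
definition invariant_factors :: "('a, 'b) monoid_scheme \<Rightarrow> nat list" where
  "invariant_factors G = (SOME ns. is_invariant_factors G ns)"

definition group_rank :: "('a, 'b) monoid_scheme \<Rightarrow> nat" where
  "group_rank G = length (invariant_factors G)"

definition group_exp :: "('a, 'b) monoid_scheme \<Rightarrow> nat" where
  "group_exp G = (if invariant_factors G = [] then 1 else last (invariant_factors G))"

definition Dstar :: "('a, 'b) monoid_scheme \<Rightarrow> nat" where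
  "Dstar G = 1 + (\<Sum>n\<leftarrow>invariant_factors G. n - 1)"

text \<open>The exponent \<open>p ^ 0\<close> is allowed, so the trivial group is a \<open>p\<close>-group.\<close>
definition is_p_group :: "('a, 'b) monoid_scheme \<Rightarrow> bool" where
  "is_p_group G \<longleftrightarrow> (\<exists>(p::nat) m. Factorial_Ring.prime p \<and> group_exp G = p ^ m)"

section \<open>Zero-sum sequences and Davenport constants\<close>

definition seq_sum :: "('a, 'b) monoid_scheme \<Rightarrow> 'a multiset \<Rightarrow> 'a" where
  "seq_sum G S = (\<Otimes>\<^bsub>G\<^esub>g\<in>set_mset S. g [^]\<^bsub>G\<^esub> count S g)"

definition minimal_zero_sum :: "('a, 'b) monoid_scheme \<Rightarrow> 'a multiset \<Rightarrow> bool" where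
  "minimal_zero_sum G S \<longleftrightarrow>
     set_mset S \<subseteq> carrier G \<and> S \<noteq> {#} \<and> seq_sum G S = \<one>\<^bsub>G\<^esub> \<and>
     (\<forall>T. T \<subset># S \<and> T \<noteq> {#} \<longrightarrow> seq_sum G T \<noteq> \<one>\<^bsub>G\<^esub>)"

text \<open>Subtraction on \<^typ>\<open>nat\<close> truncates, so \<open>count S g - 1\<close> is \<open>max {0, v\<^sub>g(S) - 1}\<close>.\<close>
definition cumulated_mult :: "('a, 'b) monoid_scheme \<Rightarrow> 'a multiset \<Rightarrow> nat" where
  "cumulated_mult G S = (\<Sum>g\<in>carrier G. count S g - 1)"

text \<open>
  If \<open>G\<close> is finite, then minimal zero-sum sequences have length at most \<open>order G\<close>, and
  the sequence consisting of a single zero is one of them with cumulated multiplicity \<open>0\<close>.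
  Hence the maxima below range over finite non-empty sets.
\<close>
definition davenport :: "('a, 'b) monoid_scheme \<Rightarrow> nat" where
  "davenport G = Max {size S | S. minimal_zero_sum G S}"

definition strong_davenport :: "nat \<Rightarrow> ('a, 'b) monoid_scheme \<Rightarrow> nat" where
  "strong_davenport k G = Max {size S | S. minimal_zero_sum G S \<and> cumulated_mult G S \<le> k}"

end

theory Submission
  imports Defs
begin

text \<open>
  Write \<open>G\<close> additively in this overview, with invariant factors \<open>n\<^sub>1 | \<dots> | n\<^sub>r\<close> and
  \<open>n = n\<^sub>r\<close> its exponent. No minimal zero-sum sequence is longer than the Davenport constant, and
  for \<open>p\<close>-groups this constant equals \<open>D\<^sup>*(G)\<close> by Olson's theorem. So everything rests on
  producing one minimal zero-sum sequence of length \<open>D\<^sup>*(G)\<close> with few repetitions.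

  The construction (\<open>minimal_zero_sum_expand\<close>) climbs from a subgroup \<open>H\<close> to \<open>H \<oplus> \<langle>b\<rangle>\<close>, where
  \<open>b\<close> has order \<open>m\<close>. Given a minimal zero-sum sequence over \<open>H\<close>, replace one term \<open>s\<close> by the \<open>m\<close>
  terms \<open>b + h\<^sub>1, \<dots>, b + h\<^sub>m\<close>, where the \<open>h\<^sub>j \<in> H\<close> are arbitrary with sum \<open>s\<close>. The
  \<open>b\<close>-coordinate forces a zero-sum subsequence to use all or none of the new terms, so the result is
  again a minimal zero-sum sequence, longer by \<open>m - 1\<close>. Starting from the sequence \<open>0\<close> and adding the
  cyclic summands one after the other therefore always reaches the length \<open>D\<^sup>*(G)\<close>.

  The freedom in the \<open>h\<^sub>j\<close> controls repetitions. The summands are added in descending order of size.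
  The first one yields \<open>n\<close> equal terms, that is, cumulated multiplicity \<open>n - 1\<close>. At the second level
  one repetition is removed and at most one is created. From the third level on there are two independent
  elements of order at least \<open>m\<close>, and a non-zero \<open>s\<close> is a multiple of at most one of them;
  using multiples of the other, the \<open>h\<^sub>j\<close> can be chosen pairwise distinct
  (\<open>almost_distinct_sequence_with_sum\<close>). Replacing a repeated term then removes one repetition per level,
  which leaves cumulated multiplicity at most \<open>max {0, n + 1 - r} \<le> k\<close>
  (\<open>long_minimal_zero_sum\<close>).

  Olson's theorem (\<open>minimal_zero_sum_size_le\<close>) is proved with difference operators modulo \<open>p\<close> on the
  integer-valued functions on \<open>G\<close>; these play the role of the elements \<open>1 - X\<^sup>g\<close> of the group algebra
  over the field with \<open>p\<close> elements. The list of invariant factors is defined by a choice, so the existence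
  part of the structure theorem for finite abelian groups is proved as well
  (\<open>exists_invariant_factors\<close>).
\<close>

section \<open>Sums of sequences and minimal zero-sum sequences\<close>

context comm_group
begin

lemma seq_sum_superset:
  assumes "finite A" "A \<subseteq> carrier G" "set_mset S \<subseteq> A"
  shows "seq_sum G S = (\<Otimes>g\<in>A. g [^] count S g)"
  unfolding seq_sum_def
  by (rule finprod_mono_neutral_cong_left) (use assms in \<open>auto simp: not_in_iff\<close>)

lemma seq_sum_empty [simp]: "seq_sum G {#} = \<one>"
  by (simp add: seq_sum_def)

lemma seq_sum_closed [simp, intro]: "set_mset S \<subseteq> carrier G \<Longrightarrow> seq_sum G S \<in> carrier G"
  unfolding seq_sum_def by (rule finprod_closed) auto

lemma seq_sum_union:
  assumes "set_mset S \<subseteq> carrier G" "set_mset T \<subseteq> carrier G"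
  shows "seq_sum G (S + T) = seq_sum G S \<otimes> seq_sum G T"
proof -
  let ?A = "set_mset S \<union> set_mset T"
  have "seq_sum G (S + T) = (\<Otimes>g\<in>?A. g [^] count S g \<otimes> g [^] count T g)"
    unfolding seq_sum_def
    by (rule finprod_cong) (use assms in \<open>auto simp: simp_implies_def nat_pow_mult subset_iff\<close>)
  also have "\<dots> = (\<Otimes>g\<in>?A. g [^] count S g) \<otimes> (\<Otimes>g\<in>?A. g [^] count T g)"
    by (rule finprod_multf) (use assms in auto)
  also have "\<dots> = seq_sum G S \<otimes> seq_sum G T"
    using assms by (simp add: seq_sum_superset[where A = ?A])
  finally show ?thesis .
qed

lemma seq_sum_replicate:
  assumes "g \<in> carrier G"
  shows "seq_sum G (replicate_mset n g) = g [^] n"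
  using assms by (cases "n = 0") (simp_all add: seq_sum_def)

lemma seq_sum_single [simp]: "g \<in> carrier G \<Longrightarrow> seq_sum G {#g#} = g"
  using seq_sum_replicate[of g 1] by simp

lemma seq_sum_add_mset [simp]:
  assumes "g \<in> carrier G" "set_mset S \<subseteq> carrier G"
  shows "seq_sum G (add_mset g S) = g \<otimes> seq_sum G S"
  using seq_sum_union[of "{#g#}" S] assms by simp

lemma seq_sum_mem_subgroup:
  assumes "subgroup H G" "set_mset S \<subseteq> H"
  shows "seq_sum G S \<in> H"
  using assms(2)
proof (induction S)
  case (add g S)
  then show ?case
    using subgroup.subset[OF assms(1)] subgroup.m_closed[OF assms(1)] by (auto simp: subset_iff)
qed (use subgroup.one_closed[OF assms(1)] in simp)

lemma seq_sum_translate: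
  assumes "b \<in> carrier G" "set_mset S \<subseteq> carrier G"
  shows "seq_sum G (image_mset (\<lambda>h. b \<otimes> h) S) = b [^] size S \<otimes> seq_sum G S"
  using assms(2)
proof (induction S)
  case (add g S)
  then show ?case using assms(1)
    by (subst image_mset_add_mset, subst seq_sum_add_mset) (auto simp: m_ac subset_iff)
qed simp

lemma minimal_zero_sum_one: "minimal_zero_sum G {#\<one>#}"
  by (auto simp: minimal_zero_sum_def subset_mset.less_le dest!: mset_subset_size
        simp flip: subset_mset.less_le) 

lemma minimal_zero_sum_not_one:
  assumes "minimal_zero_sum G S" "1 < size S" "s \<in># S"
  shows "s \<noteq> \<one>"
proof
  assume "s = \<one>"
  then have "{#s#} \<subset># S" "seq_sum G {#s#} = \<one>"
    using assms(2,3) by (auto simp: subset_mset.less_le)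
  then show False using assms(1) by (auto simp: minimal_zero_sum_def)
qed

lemma minimal_zero_sum_subseteq:
  assumes "minimal_zero_sum G S" "T \<subseteq># S" "T \<noteq> {#}" "seq_sum G T = \<one>"
  shows "T = S"
  using assms by (auto simp: minimal_zero_sum_def subset_mset.less_le)

lemma cumulated_mult_eq:
  assumes "finite (carrier G)" "set_mset S \<subseteq> carrier G"
  shows "cumulated_mult G S + card (set_mset S) = size S"
proof -
  have "cumulated_mult G S = (\<Sum>g\<in>set_mset S. count S g - 1)"
    unfolding cumulated_mult_def
    by (rule sum.mono_neutral_right) (use assms in \<open>auto simp: not_in_iff\<close>)
  then have "cumulated_mult G S + card (set_mset S) = (\<Sum>g\<in>set_mset S. (count S g - 1) + 1)"
    by (simp only: sum.distrib) simp
  also have "\<dots> = (\<Sum>g\<in>set_mset S. count S g)"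
    by (rule sum.cong) (auto simp: Suc_le_eq)
  finally show ?thesis by (simp add: size_multiset_overloaded_eq)
qed

section \<open>Replacing a term in a larger group\<close>

text \<open>
  Split a zero-sum subsequence into its old terms and \<open>j\<close> of the \<open>m\<close> new ones. Its sum lies in \<open>H\<close>, hence
  so does the \<open>j\<close>-th power of \<open>b\<close>, and \<open>m\<close> divides \<open>j\<close>. If \<open>j = 0\<close>, minimality of \<open>S\<close> is contradicted,
  as \<open>s\<close> is missing; if \<open>j = m\<close>, the new terms have product \<open>s\<close>, and putting \<open>s\<close> back gives a
  zero-sum subsequence of \<open>S\<close>, which must be all of \<open>S\<close>.
\<close>

lemma minimal_zero_sum_expand:
  assumes H: "subgroup H G" and b: "b \<in> carrier G"
    and bm: "b [^] m = \<one>" and split: "\<And>k::nat. b [^] k \<in> H \<Longrightarrow> m dvd k" and m: "0 < m"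
    and S: "minimal_zero_sum G S" "set_mset S \<subseteq> H" and s: "s \<in># S"
    and T: "set_mset T \<subseteq> H" "size T = m" "seq_sum G T = s"
  shows "minimal_zero_sum G (S - {#s#} + image_mset (\<lambda>h. b \<otimes> h) T)"
proof -
  let ?A = "S - {#s#}" and ?B = "image_mset (\<lambda>h. b \<otimes> h) T"
  have Hc: "H \<subseteq> carrier G" by (rule subgroup.subset[OF H])
  have A: "set_mset ?A \<subseteq> carrier G" using S(2) Hc by (auto dest: in_diffD)
  have B: "set_mset ?B \<subseteq> carrier G" using T(1) Hc b by auto
  have sc: "s \<in> carrier G" using s S(2) Hc by auto
  have sB: "seq_sum G ?B = s"
    using seq_sum_translate[OF b, of T] T Hc bm sc by auto
  have "seq_sum G (?A + ?B) = seq_sum G (add_mset s ?A)"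
    using A B sB sc by (simp add: seq_sum_union m_comm)
  then have sum: "seq_sum G (?A + ?B) = \<one>"
    using s S(1) by (simp add: minimal_zero_sum_def)
  have min: "U = ?A + ?B" if U: "U \<subseteq># ?A + ?B" "U \<noteq> {#}" "seq_sum G U = \<one>" for U
  proof -
    \<comment> \<open>\<open>V\<close> collects the old terms of \<open>U\<close>, \<open>W\<close> the new ones.\<close>
    define V W where "V = U \<inter># ?A" and "W = U - ?A"
    have UVW: "U = V + W" unfolding V_def W_def
      by (metis add.commute diff_intersect_left_idem inter_mset_def subset_mset.diff_add subset_mset.inf_le1)
    have V: "V \<subseteq># ?A" by (simp add: V_def)
    have W: "W \<subseteq># ?B" unfolding W_def using U(1) by (simp add: subset_eq_diff_conv add.commute)
    obtain T' where T': "T' \<subseteq># T" "W = image_mset (\<lambda>h. b \<otimes> h) T'"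
      using image_mset_eq_plusD[OF subset_mset.add_diff_inverse[OF W, symmetric]] by (metis mset_subset_eq_add_left)
    have T'H: "set_mset T' \<subseteq> H" using T' T(1) by (meson order_trans set_mset_mono)
    have VH: "set_mset V \<subseteq> H" using V S(2) by (meson order_trans set_mset_mono in_diffD subsetI)
    have Vc: "set_mset V \<subseteq> carrier G" and T'c: "set_mset T' \<subseteq> carrier G" using VH T'H Hc by auto
    then have Wc: "set_mset W \<subseteq> carrier G" using T' b by auto
    let ?v = "seq_sum G V" and ?t = "seq_sum G T'"
    have vt: "?v \<in> H" "?t \<in> H" "?v \<in> carrier G" "?t \<in> carrier G"
      using seq_sum_mem_subgroup[OF H] VH T'H Vc T'c by auto
    have eq: "?v \<otimes> (b [^] size T' \<otimes> ?t) = \<one>"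
      using U(3) Vc Wc T'(2) seq_sum_translate[OF b T'c] by (simp add: UVW seq_sum_union)
    then have "b [^] size T' = inv (?v \<otimes> ?t)"
      using vt b by (intro inv_equality[symmetric]) (auto simp: m_ac)
    also have "\<dots> \<in> H" using vt H by (auto intro: subgroup.m_inv_closed subgroup.m_closed)
    finally have dvd: "m dvd size T'" by (rule split)
    have "size T' \<le> m" using T' T(2) size_mset_mono by blast
    then consider "size T' = 0" | "size T' = m"
      using dvd m by (metis dvd_imp_le le_antisym not_gr_zero)
    then show ?thesis
    proof cases
      case 1
      then have "U = V" using T'(2) UVW by simp
      then have "U \<subseteq># S" "seq_sum G U = \<one>" using V U(3)
        by (auto intro: subset_mset.order_trans[OF _ diff_subset_eq_self])
      then have "U = S" using minimal_zero_sum_subseteq[OF S(1)] U(2) by blast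
      then have "S \<subseteq># S - {#s#}" using V \<open>U = V\<close> by simp
      then have "size S \<le> size (S - {#s#})" by (rule size_mset_mono)
      moreover have "0 < size S" using s by (auto simp: nonempty_has_size[symmetric])
      ultimately show ?thesis using s by (simp add: size_Diff_singleton)
    next
      case 2
      then have "T' = T" using T'(1) T(2) by (metis mset_subset_size nat_less_le subset_mset.less_le)
      then have WB: "W = ?B" using T' by simp
      have "seq_sum G (add_mset s V) = \<one>"
        using U(3) Vc Wc sc sB by (simp add: UVW seq_sum_union WB m_comm)
      moreover have "add_mset s V \<subseteq># S"
        using V s by (metis insert_DiffM mset_subset_eq_add_mset_cancel)
      ultimately have "add_mset s V = S" by (intro minimal_zero_sum_subseteq[OF S(1)]) simp_all
      then have "V = ?A" by (metis add_mset_remove_trivial)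
      then show ?thesis by (simp only: UVW WB)
    qed
  qed
  have "?A + ?B \<noteq> {#}" using T(2) m by auto
  then show ?thesis
    unfolding minimal_zero_sum_def using A B sum min by (auto simp: subset_mset.less_le)
qed

text \<open>
  The new terms lie outside \<open>H\<close>, so they collide neither with the old ones nor, beyond the collisions
  within \<open>T\<close>, with each other: the number of distinct terms is additive.
\<close>

lemma expand_card_set:
  assumes H: "subgroup H G" and b: "b \<in> carrier G" "b \<notin> H"
    and S: "set_mset S \<subseteq> H" "s \<in># S"
    and T: "set_mset T \<subseteq> H"
  shows "card (set_mset (S - {#s#} + image_mset (\<lambda>h. b \<otimes> h) T))
       = card (set_mset (S - {#s#})) + card (set_mset T)"
proof -
  have Hc: "H \<subseteq> carrier G" by (rule subgroup.subset[OF H])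
  have "b \<otimes> h \<notin> H" if "h \<in> H" for h
  proof
    assume "b \<otimes> h \<in> H"
    then have "b \<otimes> h \<otimes> inv h \<in> H" using H that by (auto intro: subgroup.m_closed subgroup.m_inv_closed)
    then show False using that b Hc by (auto simp: m_assoc)
  qed
  then have "set_mset (S - {#s#}) \<inter> (\<lambda>h. b \<otimes> h) ` set_mset T = {}"
    using S T by (auto dest: in_diffD)
  moreover have "inj_on (\<lambda>h. b \<otimes> h) (set_mset T)"
    using T Hc b by (intro inj_onI) (meson l_cancel subsetD)
  ultimately show ?thesis by (simp add: card_Un_disjoint card_image)
qed

text \<open>
  Take \<open>m - 1\<close> distinct powers of \<open>u\<close> and let the last term correct the product. The correction is a
  power of \<open>u\<close> only if \<open>s\<close> is one, so otherwise it is new.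
\<close>

lemma almost_distinct_sequence_with_sum:
  assumes H: "subgroup H G" and u: "u \<in> H" and inj: "inj_on (\<lambda>i::nat. u [^] i) {..<m - 1}"
    and m: "0 < m" and s: "s \<in> H"
  obtains T where "set_mset T \<subseteq> H" "size T = m" "seq_sum G T = s"
    "m \<le> card (set_mset T) + 1" "s \<notin> range (\<lambda>i::nat. u [^] i) \<Longrightarrow> card (set_mset T) = m"
proof -
  have Hc: "H \<subseteq> carrier G" by (rule subgroup.subset[OF H])
  have uc: "u \<in> carrier G" and sc: "s \<in> carrier G" using u s Hc by auto
  have pow: "\<exists>k::nat. seq_sum G (image_mset (\<lambda>i. u [^] i) M) = u [^] k" for M :: "nat multiset"
  proof (induction M)
    case (add i M)
    then obtain k :: nat where "seq_sum G (image_mset (\<lambda>i. u [^] i) M) = u [^] k" by blast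
    then have "seq_sum G (image_mset (\<lambda>i. u [^] i) (add_mset i M)) = u [^] (i + k)"
      using uc by (subst image_mset_add_mset, subst seq_sum_add_mset) (auto simp: nat_pow_mult)
    then show ?case by blast
  qed (auto intro: exI[of _ 0])
  define M where "M = image_mset (\<lambda>i. u [^] i) (mset_set {..<m - 1})"
  obtain k :: nat where k: "seq_sum G M = u [^] k" using pow unfolding M_def by blast
  define w where "w = s \<otimes> inv (u [^] k)"
  have powH: "u [^] (i::nat) \<in> H" for i
    by (induction i) (use H u in \<open>auto intro: subgroup.one_closed subgroup.m_closed\<close>)
  have wH: "w \<in> H" unfolding w_def using H s powH by (auto intro: subgroup.m_closed subgroup.m_inv_closed)
  have MH: "set_mset M \<subseteq> H" unfolding M_def using powH by auto
  have setM: "set_mset M = (\<lambda>i. u [^] i) ` {..<m - 1}" unfolding M_def by simp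
  have cM: "card (set_mset M) = m - 1" unfolding setM using card_image[OF inj] by simp
  show ?thesis
  proof
    show "set_mset (add_mset w M) \<subseteq> H" using wH MH by simp
    show "size (add_mset w M) = m" using m by (simp add: M_def)
    show "seq_sum G (add_mset w M) = s"
      using wH MH Hc uc sc by (subst seq_sum_add_mset) (auto simp: k w_def m_assoc)
    show "m \<le> card (set_mset (add_mset w M)) + 1"
      using cM m by (auto simp: card_insert_if)
    assume ns: "s \<notin> range (\<lambda>i::nat. u [^] i)"
    have "w \<notin> set_mset M"
    proof
      assume "w \<in> set_mset M"
      then obtain i :: nat where "w = u [^] i" by (auto simp: setM)
      then have "s = u [^] (i + k)"
        using uc sc unfolding w_def by (metis inv_closed inv_solve_right nat_pow_closed nat_pow_mult)
      then show False using ns by auto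
    qed
    then show "card (set_mset (add_mset w M)) = m" using cM m by simp
  qed
qed

end

section \<open>Towers of direct summands\<close>

text \<open>
  An internal form of \<open>G \<cong> C\<^bsub>m 0\<^esub> \<oplus> C\<^bsub>m 1\<^esub> \<oplus> \<dots>\<close>: level \<open>t + 1\<close> is the direct sum of level \<open>t\<close> and
  the cyclic group generated by \<open>b t\<close>. The orders descend, because the construction of long sequences
  needs the largest summands first, whereas invariant factors are listed in ascending order.
\<close>

locale split_tower = comm_group G for G (structure) +
  fixes r :: nat and m :: "nat \<Rightarrow> nat" and H :: "nat \<Rightarrow> 'a set" and b :: "nat \<Rightarrow> 'a"
  assumes H_subgroup: "t \<le> r \<Longrightarrow> subgroup (H t) G"
    and H_0: "H 0 = {\<one>}" and H_top: "H r = carrier G"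
    and H_Suc: "t < r \<Longrightarrow> H t \<subseteq> H (Suc t)"
    and b_mem: "t < r \<Longrightarrow> b t \<in> H (Suc t)"
    and b_pow: "t < r \<Longrightarrow> b t [^] m t = \<one>"
    and b_split: "t < r \<Longrightarrow> b t [^] (k::nat) \<in> H t \<Longrightarrow> m t dvd k"
    and H_step: "t < r \<Longrightarrow> x \<in> H (Suc t) \<Longrightarrow> \<exists>y\<in>H t. \<exists>k::nat. x = y \<otimes> b t [^] k"
    and m_gt_1: "t < r \<Longrightarrow> 1 < m t"
    and m_dvd: "Suc t < r \<Longrightarrow> m (Suc t) dvd m t"
begin

lemma H_carrier: "t \<le> r \<Longrightarrow> H t \<subseteq> carrier G"
  using H_subgroup subgroup.subset by blast

lemma b_carrier: "t < r \<Longrightarrow> b t \<in> carrier G"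
  using b_mem H_carrier[of "Suc t"] by auto

lemma H_mono: "s \<le> t \<Longrightarrow> t \<le> r \<Longrightarrow> H s \<subseteq> H t"
proof (induction t rule: dec_induct)
  case (step n)
  then show ?case using H_Suc[of n] by auto
qed simp

lemma b_notin_H: "t < r \<Longrightarrow> b t \<notin> H t"
  using b_split[of t 1] m_gt_1[of t] b_carrier[of t] by auto

lemma m_antimono: "s \<le> t \<Longrightarrow> t < r \<Longrightarrow> m t \<le> m s"
proof (induction t rule: dec_induct)
  case (step n)
  then have "m (Suc n) \<le> m n" using m_dvd[of n] m_gt_1[of n] by (auto intro: dvd_imp_le)
  then show ?case using step by simp
qed simp

lemma inj_on_pow_b:
  assumes "t < r"
  shows "inj_on (\<lambda>i::nat. b t [^] i) {..<m t}"
proof (rule linorder_inj_onI)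
  fix i j :: nat
  assume ij: "i < j" "i \<in> {..<m t}" "j \<in> {..<m t}"
  have bc: "b t \<in> carrier G" using b_carrier assms by simp
  show "b t [^] i \<noteq> b t [^] j"
  proof
    assume "b t [^] i = b t [^] j"
    also have "\<dots> = b t [^] i \<otimes> b t [^] (j - i)" using bc ij by (simp add: nat_pow_mult)
    finally have "b t [^] i \<otimes> b t [^] (j - i) = b t [^] i \<otimes> \<one>" using bc by simp
    then have "b t [^] (j - i) = \<one>" using bc by (subst (asm) l_cancel) auto
    then have "m t dvd j - i"
      using b_split[OF assms] H_subgroup[of t] assms subgroup.one_closed by fastforce
    then show False using ij by (auto dest: dvd_imp_le)
  qed
qed auto

lemma pow_b_Int:
  assumes "1 < r" "x \<in> range (\<lambda>i::nat. b 0 [^] i)" "x \<in> range (\<lambda>i::nat. b 1 [^] i)"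
  shows "x = \<one>"
proof -
  obtain i :: nat where "x = b 0 [^] i" using assms(2) by blast
  moreover obtain j :: nat where "x = b 1 [^] j" using assms(3) by blast
  ultimately have x: "x = b 0 [^] i" "x = b 1 [^] j" .
  have "b 0 [^] k \<in> H 1" for k :: nat
    by (induction k) (use assms b_mem[of 0] H_subgroup[of 1] in
        \<open>auto intro: subgroup.one_closed subgroup.m_closed\<close>)
  then have "m 1 dvd j" using b_split[of 1 j] x assms by metis
  then obtain l where "j = m 1 * l" by (auto elim: dvdE)
  then show ?thesis using x(2) b_pow[of 1] b_carrier[of 1] assms by (simp flip: nat_pow_pow)
qed

section \<open>Long minimal zero-sum sequences with few repetitions\<close>

lemma add_level:
  assumes t: "t < r" and S: "minimal_zero_sum G S" "set_mset S \<subseteq> H t" and s: "s \<in># S"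
    and T: "set_mset T \<subseteq> H t" "size T = m t" "seq_sum G T = s"
  obtains S' where "minimal_zero_sum G S'" "set_mset S' \<subseteq> H (Suc t)"
    "size S' = size S + (m t - 1)"
    "card (set_mset S') = card (set_mset (S - {#s#})) + card (set_mset T)"
proof
  let ?S = "S - {#s#} + image_mset (\<lambda>h. b t \<otimes> h) T"
  have sg: "subgroup (H t) G" "subgroup (H (Suc t)) G" using H_subgroup t by auto
  have H: "H t \<subseteq> H (Suc t)" using H_Suc t by simp
  show "minimal_zero_sum G ?S"
    by (rule minimal_zero_sum_expand[OF sg(1) b_carrier b_pow b_split _ S s T])
      (use t m_gt_1[of t] in auto)
  show "set_mset ?S \<subseteq> H (Suc t)"
    using S(2) T(1) H b_mem[OF t] sg(2) by (auto intro: subgroup.m_closed dest: in_diffD)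
  have "0 < size S" using s by (auto simp: nonempty_has_size[symmetric])
  then show "size ?S = size S + (m t - 1)"
    using T(2) s m_gt_1[OF t] by (simp add: size_Diff_singleton)
  show "card (set_mset ?S) = card (set_mset (S - {#s#})) + card (set_mset T)"
    by (rule expand_card_set[OF sg(1) b_carrier b_notin_H S(2) s T(1)]) (use t in auto)
qed

lemma long_minimal_zero_sum_1:
  assumes "0 < r"
  obtains S where "minimal_zero_sum G S" "set_mset S \<subseteq> H 1" "size S = m 0"
    "size S \<le> card (set_mset S) + (m 0 - 1)"
proof -
  have "seq_sum G (replicate_mset (m 0) \<one>) = \<one>" by (simp add: seq_sum_replicate)
  then obtain S where S: "minimal_zero_sum G S" "set_mset S \<subseteq> H (Suc 0)"
    "size S = size {#\<one>#} + (m 0 - 1)"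
    "card (set_mset S) = card (set_mset ({#\<one>#} - {#\<one>#})) + card (set_mset (replicate_mset (m 0) \<one>))"
    using m_gt_1[OF assms]
    by (elim add_level[OF assms minimal_zero_sum_one, of \<one> "replicate_mset (m 0) \<one>", rotated -1])
      (auto simp: H_0)
  show ?thesis
    by (rule that[of S]) (use S m_gt_1[OF assms] in auto)
qed

text \<open>
  The number of repetitions is \<open>m 0 - 1\<close> at level 1 and at most that at level 2, where the term that
  corrects the sum may create one again; then it drops by one with each level until it reaches 0.
\<close>

lemma long_minimal_zero_sum:
  assumes "2 \<le> t" "t \<le> r"
  shows "\<exists>S. minimal_zero_sum G S \<and> set_mset S \<subseteq> H t \<and> size S = 1 + (\<Sum>i<t. m i - 1)
    \<and> size S \<le> card (set_mset S) + (m 0 + 1 - t)"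
  using assms
proof (induction t rule: dec_induct)
  case base
  then have r: "0 < r" "1 < r" by auto
  obtain S where S: "minimal_zero_sum G S" "set_mset S \<subseteq> H 1" "size S = m 0"
    "size S \<le> card (set_mset S) + (m 0 - 1)"
    using long_minimal_zero_sum_1[OF r(1)] .
  obtain s where s: "s \<in># S" using S(1) by (auto simp: minimal_zero_sum_def)
  have sH: "s \<in> H 1" using S s by auto
  have "inj_on (\<lambda>i::nat. b 0 [^] i) {..<m 1 - 1}"
    using inj_on_subset[OF inj_on_pow_b[OF r(1)]] m_antimono[of 0 1] r by auto
  then obtain T where T: "set_mset T \<subseteq> H 1" "size T = m 1" "seq_sum G T = s"
    "m 1 \<le> card (set_mset T) + 1"
    using almost_distinct_sequence_with_sum[of "H 1" "b 0" "m 1" s] H_subgroup[of 1] b_mem[of 0]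
      sH r m_gt_1[of 1] by auto
  obtain S' where S': "minimal_zero_sum G S'" "set_mset S' \<subseteq> H (Suc 1)"
    "size S' = size S + (m 1 - 1)"
    "card (set_mset S') = card (set_mset (S - {#s#})) + card (set_mset T)"
    using add_level[OF r(2) S(1,2) s T(1-3)] .
  have "size (S - {#s#}) = m 0 - 1" using s S(3) by (simp add: size_Diff_singleton)
  moreover have "0 < card (set_mset (S - {#s#}))"
  proof -
    have "size (S - {#s#}) \<noteq> 0" using calculation m_gt_1[OF r(1)] by simp
    then show ?thesis by (auto simp: card_gt_0_iff)
  qed
  ultimately show ?case
    using S' S(3) T m_gt_1[OF r(1)] m_gt_1[OF r(2)]
    by (intro exI[of _ S']) (auto simp: numeral_2_eq_2)
next
  case (step t)
  then have t: "t < r" and r: "0 < r" "1 < r" by auto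
  obtain S where S: "minimal_zero_sum G S" "set_mset S \<subseteq> H t" "size S = 1 + (\<Sum>i<t. m i - 1)"
    "size S \<le> card (set_mset S) + (m 0 + 1 - t)"
    using step by auto
  have "m 0 - 1 \<le> (\<Sum>i<t. m i - 1)" by (rule member_le_sum[of 0]) (use step in auto)
  then have size: "1 < size S" using S(3) m_gt_1[OF r(1)] by simp
  \<comment> \<open>Replace a repeated term if there is one; otherwise any term will do.\<close>
  have "\<exists>s\<in>#S. card (set_mset (S - {#s#})) + (m 0 + 1 - Suc t) + 1 \<ge> size S"
  proof (cases "\<exists>s. 2 \<le> count S s")
    case True
    then obtain s where s: "2 \<le> count S s" by blast
    then have "count (S - {#s#}) s \<noteq> 0" by simp
    then have "s \<in># S - {#s#}" by (meson not_in_iff)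
    moreover from this have "s \<in># S" by (rule in_diffD)
    ultimately have "set_mset (S - {#s#}) = set_mset S"
      by (metis insert_DiffM insert_absorb set_mset_add_mset_insert)
    then show ?thesis using S(4) \<open>s \<in># S\<close> by (intro bexI[of _ s]) auto
  next
    case False
    obtain s where s: "s \<in># S" using S(1) by (auto simp: minimal_zero_sum_def)
    have "count S g = 1" if "g \<in># S" for g
      using False that by (metis One_nat_def Suc_1 count_greater_zero_iff le_less_Suc_eq not_le Suc_leI)
    then have "size S = card (set_mset S)" by (simp add: size_multiset_overloaded_eq)
    moreover have "set_mset S = insert s (set_mset (S - {#s#}))"
      using s by (metis insert_DiffM set_mset_add_mset_insert)
    then have "card (set_mset S) \<le> card (set_mset (S - {#s#})) + 1"
      by (simp add: card_insert_if)
    ultimately show ?thesis using s by (intro bexI[of _ s]) auto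
  qed
  then obtain s where s: "s \<in># S" "size S \<le> card (set_mset (S - {#s#})) + (m 0 + 1 - Suc t) + 1"
    by auto
  \<comment> \<open>A non-trivial \<open>s\<close> cannot be a power of both \<open>b 0\<close> and \<open>b 1\<close>.\<close>
  have "s \<noteq> \<one>" using minimal_zero_sum_not_one[OF S(1) size s(1)] .
  then obtain u where u: "u \<in> {0, 1}" "s \<notin> range (\<lambda>i::nat. b u [^] i)"
    using pow_b_Int[OF r(2), of s] by auto
  have ur: "u < r" "u < t" using u r step by auto
  have "inj_on (\<lambda>i::nat. b u [^] i) {..<m t - 1}"
    using inj_on_subset[OF inj_on_pow_b[OF ur(1)]] m_antimono[of u t] ur t by auto
  moreover have "b u \<in> H t" using b_mem[OF ur(1)] H_mono[of "Suc u" t] ur t by auto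
  ultimately obtain T where T: "set_mset T \<subseteq> H t" "size T = m t" "seq_sum G T = s"
    "card (set_mset T) = m t"
    using almost_distinct_sequence_with_sum[of "H t" "b u" "m t" s] H_subgroup[of t]
      s(1) S(2) t m_gt_1[of t] u(2) by auto
  obtain S' where S': "minimal_zero_sum G S'" "set_mset S' \<subseteq> H (Suc t)"
    "size S' = size S + (m t - 1)"
    "card (set_mset S') = card (set_mset (S - {#s#})) + card (set_mset T)"
    using add_level[OF t S(1,2) s(1) T(1-3)] .
  then show ?case using S(3) s(2) T(4) m_gt_1[OF t] by (intro exI[of _ S']) auto
qed

end

section \<open>Olson's theorem for p-groups\<close>

text \<open>
  The group algebra acts on functions by translations; \<open>diff_op G g\<close> is the action of \<open>1 - X\<^sup>g\<close>. Cutting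
  the result off outside the carrier makes these operators commute as functions, which is what allows
  the product over a list to be reordered.
\<close>

definition diff_op :: "('a, 'b) monoid_scheme \<Rightarrow> 'a \<Rightarrow> ('a \<Rightarrow> int) \<Rightarrow> 'a \<Rightarrow> int" where
  "diff_op G g f = (\<lambda>x. if x \<in> carrier G then f x - f (x \<otimes>\<^bsub>G\<^esub> g) else 0)"

lemma diff_op_apply:
  "x \<in> carrier G \<Longrightarrow> diff_op G g f x = f x - f (x \<otimes>\<^bsub>G\<^esub> g)"
  by (simp add: diff_op_def)

lemma alternating_binomial_sum_Suc:
  fixes a :: "nat \<Rightarrow> 'r :: comm_ring_1"
  shows "(\<Sum>k\<le>n. (-1) ^ k * of_nat (n choose k) * a k) -
         (\<Sum>k\<le>n. (-1) ^ k * of_nat (n choose k) * a (Suc k)) =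
         (\<Sum>k\<le>Suc n. (-1) ^ k * of_nat (Suc n choose k) * a k)"
proof -
  have "(\<Sum>k\<le>n. (-1) ^ k * of_nat (n choose k) * a k) =
        (\<Sum>k\<le>Suc n. (-1) ^ k * of_nat (n choose k) * a k)"
    by (simp add: binomial_eq_0)
  also have "\<dots> = a 0 + (\<Sum>k\<le>n. (-1) ^ Suc k * of_nat (n choose Suc k) * a (Suc k))"
    by (subst sum.atMost_Suc_shift) simp
  finally show ?thesis
    by (subst sum.atMost_Suc_shift) (simp add: algebra_simps sum.distrib sum_negf sum_subtractf)
qed

lemma prime_dvd_choose_prime_power:
  fixes p :: nat
  assumes "Factorial_Ring.prime p" "0 < k" "k < p ^ c"
  shows "p dvd (p ^ c choose k)"
proof (rule ccontr)
  assume "\<not> p dvd (p ^ c choose k)"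
  then have "coprime (p ^ c) (p ^ c choose k)"
    using assms(1) by (simp add: prime_imp_coprime)
  moreover have "k * (p ^ c choose k) = p ^ c * (p ^ c - 1 choose (k - 1))"
    using assms by (intro times_binomial_minus1_eq) auto
  then have "p ^ c dvd k * (p ^ c choose k)" by simp
  ultimately have "p ^ c dvd k" by (simp add: coprime_dvd_mult_left_iff)
  then show False using assms by (auto dest: dvd_imp_le)
qed

context comm_group
begin

lemma diff_op_commute:
  assumes "g \<in> carrier G" "h \<in> carrier G"
  shows "diff_op G g \<circ> diff_op G h = diff_op G h \<circ> diff_op G g"
  using assms by (auto simp: diff_op_def fun_eq_iff m_ac)

lemma fold_diff_op_mset_eq:
  assumes "set gs \<subseteq> carrier G" "mset gs = mset hs"
  shows "fold (diff_op G) gs f = fold (diff_op G) hs f"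
  by (subst fold_multiset_equiv[OF _ assms(2)]) (use assms(1) diff_op_commute in auto)

lemma funpow_diff_op:
  assumes "g \<in> carrier G" "x \<in> carrier G"
  shows "(diff_op G g ^^ n) f x = (\<Sum>k\<le>n. (-1) ^ k * int (n choose k) * f (x \<otimes> g [^] k))"
  using assms(2)
proof (induction n arbitrary: x)
  case (Suc n)
  have "x \<otimes> g \<otimes> g [^] k = x \<otimes> g [^] Suc k" for k :: nat
    using Suc.prems assms(1) by (simp add: m_ac)
  then show ?case
    using Suc assms(1) alternating_binomial_sum_Suc[of n "\<lambda>k. f (x \<otimes> g [^] k)"]
    by (simp add: diff_op_apply del: sum.atMost_Suc)
qed simp

text \<open>
  The identity \<open>(1 - X)\<^bsup>p ^ c\<^esup> = 1 - X\<^bsup>p ^ c\<^esup>\<close> modulo \<open>p\<close>, in operator form: the inner terms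
  of the binomial expansion vanish modulo \<open>p\<close>. As \<open>g\<close> to the power \<open>p ^ c\<close> is trivial, the outer ones
  cancel if \<open>p ^ c\<close> is odd; if it is even, they are equal and \<open>p = 2\<close> divides their sum.
\<close>

lemma prime_dvd_funpow_diff_op:
  fixes p :: nat
  assumes p: "Factorial_Ring.prime p" and g: "g \<in> carrier G" "g [^] (p ^ c) = \<one>"
    and x: "x \<in> carrier G"
  shows "int p dvd (diff_op G g ^^ (p ^ c)) f x"
proof -
  let ?n = "p ^ c"
  let ?t = "\<lambda>k. (-1) ^ k * int (?n choose k) * f (x \<otimes> g [^] k)"
  have n: "0 < ?n" using p by (simp add: prime_gt_0_nat)
  have "(\<Sum>k\<le>?n. ?t k) = ?t 0 + ?t ?n + (\<Sum>k\<in>{0<..<?n}. ?t k)"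
  proof -
    have "{..?n} = {0, ?n} \<union> {0<..<?n}" using n by auto
    moreover have "(\<Sum>k\<in>{0, ?n} \<union> {0<..<?n}. ?t k) = (\<Sum>k\<in>{0, ?n}. ?t k) + (\<Sum>k\<in>{0<..<?n}. ?t k)"
      by (rule sum.union_disjoint) auto
    ultimately show ?thesis using n by simp
  qed
  moreover have "int p dvd (\<Sum>k\<in>{0<..<?n}. ?t k)"
    by (rule dvd_sum) (use prime_dvd_choose_prime_power[OF p] in auto)
  moreover have "int p dvd ?t 0 + ?t ?n"
  proof (cases "even ?n")
    case True
    then have "p = 2" using p by (metis even_power prime_nat_iff two_is_prime_nat primes_dvd_imp_eq)
    then show ?thesis using True g x by simp
  next
    case False
    then show ?thesis using g x by simp
  qed
  ultimately show ?thesis using funpow_diff_op[OF g(1) x, of ?n f] by (simp add: dvd_add)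
qed

lemma dvd_fold_diff_op:
  assumes "set gs \<subseteq> carrier G" "\<And>x. x \<in> carrier G \<Longrightarrow> q dvd f x" "x \<in> carrier G"
  shows "q dvd fold (diff_op G) gs f x"
  using assms
proof (induction gs arbitrary: f)
  case (Cons g gs)
  have "q dvd diff_op G g f y" if "y \<in> carrier G" for y
    using Cons.prems that by (auto simp: diff_op_def)
  then show ?case using Cons by auto
qed simp

text \<open>
  Expanding the product, the value at \<open>x\<close> is the signed number of subsequences with product \<open>x\<^sup>-\<^sup>1\<close>.
  These counts are what the vanishing modulo \<open>p\<close> is played off against: for \<open>x = \<one>\<close> and a sequence
  without non-empty zero-sum subsequence, only the empty subsequence contributes.
\<close>

lemma fold_diff_op_delta_eq_0:
  assumes "set gs \<subseteq> carrier G" "x \<in> carrier G"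
    and "\<And>T. T \<subseteq># mset gs \<Longrightarrow> x \<otimes> seq_sum G T \<noteq> \<one>"
  shows "fold (diff_op G) gs (\<lambda>y. if y = \<one> then 1 else 0) x = 0"
  using assms
proof (induction gs arbitrary: x rule: rev_induct)
  case Nil
  then show ?case using Nil(3)[of "{#}"] by simp
next
  case (snoc g gs)
  have g: "g \<in> carrier G" using snoc.prems by simp
  have "x \<otimes> g \<otimes> seq_sum G T \<noteq> \<one>" if "T \<subseteq># mset gs" for T
  proof -
    have "set_mset T \<subseteq> carrier G"
      using that snoc.prems(1) by (metis le_sup_iff order_trans set_append set_mset_mono set_mset_mset)
    then show ?thesis using that snoc.prems(2) snoc.prems(3)[of "add_mset g T"] g
      by (simp add: m_assoc)
  qed
  moreover have "x \<otimes> seq_sum G T \<noteq> \<one>" if "T \<subseteq># mset gs" for T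
    using snoc.prems(3)[of T] that by (simp add: subset_mset.add_increasing2 subset_mset.order_trans[OF that])
  ultimately show ?case using snoc g by (simp add: diff_op_apply)
qed

lemma fold_diff_op_delta_eq_1:
  assumes "set gs \<subseteq> carrier G"
    and "\<And>T. T \<subseteq># mset gs \<Longrightarrow> T \<noteq> {#} \<Longrightarrow> seq_sum G T \<noteq> \<one>"
  shows "fold (diff_op G) gs (\<lambda>y. if y = \<one> then 1 else 0) \<one> = 1"
  using assms
proof (induction gs rule: rev_induct)
  case (snoc g gs)
  have g: "g \<in> carrier G" using snoc.prems by simp
  have "g \<otimes> seq_sum G T \<noteq> \<one>" if "T \<subseteq># mset gs" for T
  proof -
    have "set_mset T \<subseteq> carrier G"
      using that snoc.prems(1) by (metis le_sup_iff order_trans set_append set_mset_mono set_mset_mset)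
    then show ?thesis using that snoc.prems(2)[of "add_mset g T"] g by simp
  qed
  then have "fold (diff_op G) gs (\<lambda>y. if y = \<one> then 1 else 0) g = 0"
    using g snoc.prems by (intro fold_diff_op_delta_eq_0) auto
  moreover have "seq_sum G T \<noteq> \<one>" if "T \<subseteq># mset gs" "T \<noteq> {#}" for T
    using snoc.prems(2)[of T] that by (simp add: subset_mset.order_trans[OF that(1)])
  ultimately show ?case using snoc g by (simp add: diff_op_apply)
qed simp

end

context split_tower
begin

lemma generator_induct [consumes 1, case_names one mult]:
  assumes x: "x \<in> carrier G" and one: "P \<one>"
    and mult: "\<And>x t. x \<in> carrier G \<Longrightarrow> t < r \<Longrightarrow> P x \<Longrightarrow> P (x \<otimes> b t)"
  shows "P x"
proof -
  have pow: "P (y \<otimes> b t [^] k)" if "y \<in> carrier G" "t < r" "P y" for y t and k :: nat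
    using that mult b_carrier by (induction k) (simp_all flip: m_assoc)
  have "\<forall>x\<in>H t. P x" if "t \<le> r" for t
    using that
  proof (induction t)
    case (Suc t)
    show ?case
    proof
      fix x assume "x \<in> H (Suc t)"
      then obtain y and k :: nat where "y \<in> H t" "x = y \<otimes> b t [^] k"
        using H_step Suc.prems by (metis Suc_le_eq)
      then show "P x" using pow[of y t k] Suc H_carrier[of t] by auto
    qed
  qed (simp add: H_0 one)
  then show ?thesis using x H_top by blast
qed

text \<open>
  In the group algebra over the field with \<open>p\<close> elements, every \<open>1 - X\<^sup>g\<close> is in the ideal generated by the
  \<open>1 - X\<^bsup>b t\<^esup>\<close>, as \<open>1 - X\<^bsup>g + h\<^esup> = (1 - X\<^sup>g) + X\<^sup>g (1 - X\<^sup>h)\<close>. A product of more than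
  \<open>\<Sum> (m t - 1)\<close> of them is thus a combination of products of as many generators, and in each of these
  some generator \<open>t\<close> occurs at least \<open>m t\<close> times, which annihilates it. The induction performs this
  rewriting one factor at a time, with \<open>gs\<close> the factors still to be rewritten and \<open>ts\<close> the generators
  obtained so far.
\<close>

lemma prime_dvd_fold_diff_op:
  fixes p :: nat
  assumes p: "Factorial_Ring.prime p" and m: "\<And>t. t < r \<Longrightarrow> \<exists>c. m t = p ^ c"
    and "set gs \<subseteq> carrier G" "set ts \<subseteq> {..<r}"
    and "(\<Sum>t<r. m t - 1) < length gs + length ts" "x \<in> carrier G"
  shows "int p dvd fold (diff_op G) (gs @ map b ts) f x"
  using assms(3-)
proof (induction gs arbitrary: ts x)
  case Nil
  have "\<exists>t<r. m t \<le> count_list ts t"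
  proof (rule ccontr)
    assume "\<not> ?thesis"
    then have "(\<Sum>t<r. count_list ts t) \<le> (\<Sum>t<r. m t - 1)" by (intro sum_mono) auto
    moreover have "(\<Sum>t<r. count_list ts t) = length ts"
      using Nil.prems(2) by (simp add: sum_count_set)
    ultimately show False using Nil.prems by simp
  qed
  then obtain t where t: "t < r" "m t \<le> count_list ts t" by blast
  then have "replicate_mset (m t) t \<subseteq># mset ts"
    by (simp add: count_le_replicate_mset_subset_eq[symmetric] count_mset)
  then obtain M where M: "mset ts = replicate_mset (m t) t + M"
    by (auto simp: subset_mset.le_iff_add)
  obtain us where us: "mset us = M" using ex_mset by blast
  have "set us \<subseteq> set ts" using M us by (metis mset_subset_eq_add_right set_mset_mono set_mset_mset)
  then have usc: "set (map b us) \<subseteq> carrier G" using Nil.prems b_carrier by auto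
  obtain c where c: "m t = p ^ c" using m t by blast
  have "fold (diff_op G) (map b ts) f = fold (diff_op G) (replicate (m t) (b t) @ map b us) f"
    by (rule fold_diff_op_mset_eq) (use Nil.prems b_carrier M us in auto)
  also have "\<dots> = fold (diff_op G) (map b us) ((diff_op G (b t) ^^ (p ^ c)) f)"
    by (simp add: fold_replicate c)
  finally have "fold (diff_op G) (map b ts) f = fold (diff_op G) (map b us) ((diff_op G (b t) ^^ (p ^ c)) f)" .
  moreover have "int p dvd fold (diff_op G) (map b us) ((diff_op G (b t) ^^ (p ^ c)) f) x"
    using b_pow[OF t(1)] c Nil.prems(4)
    by (intro dvd_fold_diff_op[OF usc] prime_dvd_funpow_diff_op[OF p b_carrier[OF t(1)]]) simp_all
  ultimately show ?case by simp
next
  case (Cons g gs)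
  let ?F = "fold (diff_op G) (gs @ map b ts) f"
  have ts: "set (map b ts) \<subseteq> carrier G" using Cons.prems b_carrier by auto
  \<comment> \<open>A generator applied to \<open>?F\<close> counts as one more entry of \<open>ts\<close> in place of \<open>g\<close>.\<close>
  have gen: "int p dvd ?F y - ?F (y \<otimes> b t)" if "y \<in> carrier G" "t < r" for y t
  proof -
    have "?F y - ?F (y \<otimes> b t) = fold (diff_op G) ((gs @ map b ts) @ [b t]) f y"
      using that by (simp add: diff_op_apply)
    also have "\<dots> = fold (diff_op G) (gs @ map b (t # ts)) f y"
      by (subst fold_diff_op_mset_eq[of "(gs @ map b ts) @ [b t]" "gs @ map b (t # ts)"])
        (use Cons.prems ts that b_carrier in auto)
    also have "int p dvd \<dots>" by (rule Cons.IH) (use Cons.prems that in auto)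
    finally show ?thesis .
  qed
  have "\<forall>y\<in>carrier G. int p dvd ?F y - ?F (y \<otimes> h)" if "h \<in> carrier G" for h
    using that
  proof (induction h rule: generator_induct)
    case (mult h t)
    show ?case
    proof
      fix y assume y: "y \<in> carrier G"
      have bt: "b t \<in> carrier G" using b_carrier mult by simp
      have "int p dvd (?F y - ?F (y \<otimes> b t)) + (?F (y \<otimes> b t) - ?F (y \<otimes> b t \<otimes> h))"
        by (rule dvd_add) (use gen mult y bt in auto)
      also have "y \<otimes> b t \<otimes> h = y \<otimes> (h \<otimes> b t)" using y bt mult by (simp add: m_ac)
      finally show "int p dvd ?F y - ?F (y \<otimes> (h \<otimes> b t))" by simp
    qed
  qed simp
  then have "int p dvd ?F x - ?F (x \<otimes> g)" using Cons.prems by auto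
  also have "?F x - ?F (x \<otimes> g) = fold (diff_op G) ((gs @ map b ts) @ [g]) f x"
    using Cons.prems by (simp add: diff_op_apply)
  also have "\<dots> = fold (diff_op G) ((g # gs) @ map b ts) f x"
    by (subst fold_diff_op_mset_eq[of "(gs @ map b ts) @ [g]" "(g # gs) @ map b ts"])
      (use Cons.prems ts in auto)
  finally show ?case .
qed

text \<open>
  Removing one term leaves a sequence without non-empty zero-sum subsequence. If it had more than
  \<open>\<Sum> (m t - 1)\<close> terms, the corresponding product of difference operators, applied to the indicator
  function of \<open>\<one>\<close> and evaluated at \<open>\<one>\<close>, would be both 1 and divisible by \<open>p\<close>.
\<close>

theorem minimal_zero_sum_size_le:
  fixes p :: nat
  assumes p: "Factorial_Ring.prime p" and m: "\<And>t. t < r \<Longrightarrow> \<exists>c. m t = p ^ c"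
    and S: "minimal_zero_sum G S"
  shows "size S \<le> 1 + (\<Sum>t<r. m t - 1)"
proof (rule ccontr)
  assume large: "\<not> ?thesis"
  obtain s where s: "s \<in># S" using S by (auto simp: minimal_zero_sum_def)
  obtain gs where gs: "mset gs = S - {#s#}" using ex_mset by blast
  have sub: "S - {#s#} \<subset># S" using s by (simp add: subset_mset.less_le diff_single_eq_union)
  have gsc: "set gs \<subseteq> carrier G"
    using S gs by (metis in_diffD minimal_zero_sum_def set_mset_mset subset_iff)
  have "fold (diff_op G) gs (\<lambda>y. if y = \<one> then 1 else 0) \<one> = 1"
    by (rule fold_diff_op_delta_eq_1[OF gsc])
      (use S sub in \<open>auto simp: gs minimal_zero_sum_def dest: subset_mset.le_less_trans\<close>)
  moreover have "length gs = size S - 1"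
    using gs s by (metis size_Diff_singleton size_mset)
  then have "int p dvd fold (diff_op G) (gs @ map b []) (\<lambda>y. if y = \<one> then 1 else 0) \<one>"
    by (intro prime_dvd_fold_diff_op[OF p m gsc]) (use large in auto)
  ultimately show False using p by (simp add: prime_nat_iff)
qed

end

section \<open>Existence of invariant factors\<close>

context comm_group
begin

lemma subgroup_nat_pow_closed:
  assumes "subgroup M G" "x \<in> M"
  shows "x [^] (k::nat) \<in> M"
  by (induction k) (use assms in \<open>auto intro: subgroup.one_closed subgroup.m_closed\<close>)

lemma mem_subgroup_if_coprime_powers:
  assumes M: "subgroup M G" and y: "y \<in> carrier G" and ij: "coprime i j" "i \<noteq> 0"
    and mem: "y [^] (i::nat) \<in> M" "y [^] (j::nat) \<in> M"
  shows "y \<in> M"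
proof -
  obtain u v where uv: "i * u = j * v + 1" using bezout_nat[OF ij(2), of j] ij(1) by auto
  have "(y [^] i) [^] u = (y [^] j) [^] v \<otimes> y"
    using y by (simp add: nat_pow_pow uv)
  moreover have "(y [^] i) [^] u \<in> M" "(y [^] j) [^] v \<in> M"
    using mem subgroup_nat_pow_closed[OF M] by auto
  ultimately have "inv ((y [^] j) [^] v) \<otimes> ((y [^] j) [^] v \<otimes> y) \<in> M"
    using M by (auto intro: subgroup.m_closed subgroup.m_inv_closed)
  then show ?thesis using y by (simp flip: m_assoc)
qed

lemma coprime_ord_mult_dvd:
  assumes a: "a \<in> carrier G" and x: "x \<in> carrier G" and cop: "coprime (ord a) (ord x)"
  shows "ord a * ord x dvd ord (a \<otimes> x)"
proof -
  have "ord y dvd ord (y \<otimes> z)"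
    if y: "y \<in> carrier G" and z: "z \<in> carrier G" and cop: "coprime (ord y) (ord z)" for y z
  proof -
    let ?k = "ord (y \<otimes> z) * ord z"
    have "\<one> = (y \<otimes> z) [^] ?k" using y z by (simp flip: nat_pow_pow)
    also have "\<dots> = y [^] ?k \<otimes> z [^] ?k" using y z by (simp add: nat_pow_distrib)
    also have "z [^] ?k = \<one>" using z by (simp add: pow_eq_id)
    finally have "ord y dvd ?k" using y by (simp add: pow_eq_id[symmetric])
    then show ?thesis using cop by (simp add: coprime_dvd_mult_left_iff)
  qed
  from this[OF a x cop] this[OF x a] have "ord a dvd ord (a \<otimes> x)" "ord x dvd ord (a \<otimes> x)"
    using assms by (simp_all add: m_comm coprime_commute)
  then show ?thesis using cop by (rule divides_mult)
qed

text \<open>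
  Choose \<open>a\<close> of maximal order. If some order did not divide \<open>ord a\<close>, a prime \<open>p\<close> would occur in it to a
  higher power; combining the \<open>p\<close>-part of that element with the prime-to-\<open>p\<close> part of \<open>a\<close> would give an
  element of order larger than \<open>ord a\<close>.
\<close>

lemma exists_exponent_element:
  assumes fin: "finite (carrier G)" and K: "subgroup K G"
  obtains a where "a \<in> K" "\<And>x. x \<in> K \<Longrightarrow> x [^] ord a = \<one>"
proof -
  have Kc: "K \<subseteq> carrier G" by (rule subgroup.subset[OF K])
  have ne: "finite (ord ` K)" "ord ` K \<noteq> {}"
    using finite_subset[OF Kc fin] subgroup.one_closed[OF K] by auto
  have pos: "0 < ord x" if "x \<in> K" for x
    using ord_ge_1[OF fin, of x] that Kc by auto
  from Max_in[OF ne] obtain a where a: "a \<in> K" "ord a = Max (ord ` K)" by auto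
  then have max: "ord y \<le> ord a" if "y \<in> K" for y using that ne by simp
  have "ord x dvd ord a" if x: "x \<in> K" for x
  proof (rule multiplicity_le_imp_dvd)
    show "ord x \<noteq> 0" using pos[OF x] by simp
    fix p :: nat assume p: "Factorial_Ring.prime p"
    then have nu: "\<not> is_unit p" by auto
    define \<alpha> \<beta> where "\<alpha> = multiplicity p (ord a)" and "\<beta> = multiplicity p (ord x)"
    obtain u where u: "ord a = p ^ \<alpha> * u" "\<not> p dvd u"
      using multiplicity_decompose'[of "ord a" p] pos[OF a(1)] nu unfolding \<alpha>_def by auto
    obtain v where v: "ord x = p ^ \<beta> * v" "\<not> p dvd v"
      using multiplicity_decompose'[of "ord x" p] pos[OF x] nu unfolding \<beta>_def by auto
    have ac: "a \<in> carrier G" and xc: "x \<in> carrier G" using a x Kc by auto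
    have p0: "0 < p" using p by (simp add: prime_gt_0_nat)
    have uv0: "0 < u" "0 < v" using u v pos[OF a(1)] pos[OF x] by auto
    have oa: "ord (a [^] (p ^ \<alpha>)) = u" using ord_pow[OF ac, of "p ^ \<alpha>"] u p0 by auto
    have ox: "ord (x [^] v) = p ^ \<beta>" using ord_pow[OF xc, of v] v uv0 by auto
    have "coprime u (p ^ \<beta>)" using u(2) p by (simp add: prime_imp_coprime coprime_commute)
    then have "u * p ^ \<beta> dvd ord (a [^] (p ^ \<alpha>) \<otimes> x [^] v)"
      using coprime_ord_mult_dvd[of "a [^] (p ^ \<alpha>)" "x [^] v"] ac xc oa ox by simp
    moreover have mem: "a [^] (p ^ \<alpha>) \<otimes> x [^] v \<in> K"
      using K a(1) x by (auto intro: subgroup.m_closed subgroup_nat_pow_closed)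
    ultimately have "u * p ^ \<beta> \<le> ord (a [^] (p ^ \<alpha>) \<otimes> x [^] v)"
      using pos[OF mem] by (intro dvd_imp_le) simp_all
    also have "\<dots> \<le> u * p ^ \<alpha>" using max[OF mem] u(1) by (simp add: mult.commute)
    finally have "u * p ^ \<beta> \<le> u * p ^ \<alpha>" .
    then have "p ^ \<beta> \<le> p ^ \<alpha>" using uv0 by simp
    then show "multiplicity p (ord x) \<le> multiplicity p (ord a)"
      using prime_gt_1_nat[OF p] power_le_imp_le_exp unfolding \<alpha>_def \<beta>_def by blast
  qed
  then have "x [^] ord a = \<one>" if "x \<in> K" for x using that Kc by (auto simp: pow_eq_id)
  then show ?thesis using that[OF a(1)] by blast
qed

text \<open>
  A cyclic subgroup whose order is the exponent is a direct summand: a subgroup \<open>L\<close> maximal among those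
  that meet \<open>\<langle>a\<rangle>\<close> trivially is a complement. Otherwise some \<open>y\<close> outside \<open>M = L\<langle>a\<rangle>\<close> has its \<open>p\<close>-th power in
  \<open>M\<close> for a prime \<open>p\<close>. As \<open>ord a\<close> kills \<open>y\<close>, the \<open>\<langle>a\<rangle>\<close>-component of this power is itself a \<open>p\<close>-th power,
  so \<open>y\<close> can be changed by a power of \<open>a\<close> into \<open>z\<close> whose \<open>p\<close>-th power lies in \<open>L\<close>. Then \<open>L\<langle>z\<rangle>\<close> still meets
  \<open>\<langle>a\<rangle>\<close> trivially, against maximality.
\<close>

lemma exists_complement:
  assumes fin: "finite (carrier G)" and K: "subgroup K G" and a: "a \<in> K"
    and exp: "\<And>x. x \<in> K \<Longrightarrow> x [^] ord a = \<one>"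
  obtains L where "subgroup L G" "L \<subseteq> K" "\<And>k::nat. a [^] k \<in> L \<Longrightarrow> ord a dvd k"
    "\<And>x. x \<in> K \<Longrightarrow> \<exists>l\<in>L. \<exists>k::nat. x = l \<otimes> a [^] k"
proof -
  have Kc: "K \<subseteq> carrier G" by (rule subgroup.subset[OF K])
  have ac: "a \<in> carrier G" using a Kc by auto
  let ?n = "ord a"
  have npos: "0 < ?n" using ord_ge_1[OF fin ac] by simp
  define \<L> where "\<L> = {L. subgroup L G \<and> L \<subseteq> K \<and> (\<forall>k::nat. a [^] k \<in> L \<longrightarrow> ?n dvd k)}"
  have "\<L> \<subseteq> Pow (carrier G)" unfolding \<L>_def using Kc by auto
  then have "finite \<L>" using fin by (meson finite_Pow_iff finite_subset)
  moreover have "{\<one>} \<in> \<L>"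
    unfolding \<L>_def using ac K by (auto simp: pow_eq_id triv_subgroup subgroup.one_closed)
  ultimately obtain L where L: "L \<in> \<L>" and Lmax: "\<And>L'. L' \<in> \<L> \<Longrightarrow> L \<subseteq> L' \<Longrightarrow> L' = L"
    by (metis finite_has_maximal2)
  have Ls: "subgroup L G" and LK: "L \<subseteq> K" and La: "\<And>k::nat. a [^] k \<in> L \<Longrightarrow> ?n dvd k"
    using L unfolding \<L>_def by auto
  have gen: "generate G {z} = range (\<lambda>k::nat. z [^] k)" if "z \<in> carrier G" for z
    using generate_pow_on_finite_carrier[OF fin that] by auto
  have prod: "subgroup (L <#> generate G {z}) G" if "z \<in> carrier G" for z
    using that by (intro mult_subgroups Ls generate_is_subgroup) auto
  have mem_prod: "x \<in> L <#> generate G {z} \<longleftrightarrow> (\<exists>l\<in>L. \<exists>k::nat. x = l \<otimes> z [^] k)"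
    if "z \<in> carrier G" for x z
    using that by (auto simp: gen set_mult_def)
  let ?M = "L <#> generate G {a}"
  have M: "subgroup ?M G" using prod[OF ac] .
  have LM: "L \<subseteq> ?M"
    using mem_prod[OF ac] Ls subgroup.subset[OF Ls] by (metis nat_pow_0 r_one subsetD subsetI)
  have aM: "a [^] (k::nat) \<in> ?M" for k
    using mem_prod[OF ac] Ls ac by (metis l_one nat_pow_closed subgroup.one_closed)
  have "K \<subseteq> ?M"
  proof (rule ccontr)
    assume "\<not> K \<subseteq> ?M"
    then obtain x where x: "x \<in> K" "x \<notin> ?M" by auto
    have xc: "x \<in> carrier G" using x Kc by auto
    \<comment> \<open>The order of \<open>x\<close> modulo \<open>M\<close>; dividing it by a prime factor \<open>p\<close> gives \<open>y\<close>.\<close>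
    define k where "k = (LEAST k::nat. 0 < k \<and> x [^] k \<in> ?M)"
    have "0 < ?n \<and> x [^] ?n \<in> ?M" using npos exp[OF x(1)] M by (simp add: subgroup.one_closed)
    then have k: "0 < k" "x [^] k \<in> ?M"
      unfolding k_def by (metis (mono_tags, lifting) LeastI)+
    have kmin: "k \<le> j" if "0 < j" "x [^] j \<in> ?M" for j
      unfolding k_def using that by (intro Least_le) auto
    have "k \<noteq> 1" using k(2) x(2) xc by auto
    then obtain p where p: "Factorial_Ring.prime p" "p dvd k" using prime_factor_nat by blast
    then obtain j where j: "k = p * j" by (auto elim: dvdE)
    have p1: "1 < p" using p(1) prime_gt_1_nat by blast
    define y where "y = x [^] j"
    have yK: "y \<in> K" unfolding y_def using subgroup_nat_pow_closed[OF K x(1)] .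
    then have yc: "y \<in> carrier G" using Kc by auto
    have "0 < j" "j < k" using j k(1) p1 by auto
    then have yM: "y \<notin> ?M" using kmin[of j] unfolding y_def by auto
    have ypM: "y [^] p \<in> ?M" using k(2) j xc unfolding y_def by (simp add: nat_pow_pow mult.commute)
    have "p dvd ?n"
    proof (rule ccontr)
      assume "\<not> p dvd ?n"
      then have "coprime p ?n" using p(1) by (simp add: prime_imp_coprime)
      then have "y \<in> ?M"
        using p1 ypM exp[OF yK] M
        by (intro mem_subgroup_if_coprime_powers[OF M yc, of p ?n]) (auto simp: subgroup.one_closed)
      then show False using yM by simp
    qed
    then obtain q where q: "?n = p * q" by (auto elim: dvdE)
    obtain l c where lc: "l \<in> L" "y [^] p = l \<otimes> a [^] (c::nat)" using ypM mem_prod[OF ac] by blast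
    have lcar: "l \<in> carrier G" using lc(1) LK Kc by auto
    have "\<one> = (y [^] p) [^] q" using exp[OF yK] yc by (simp add: nat_pow_pow q)
    also have "\<dots> = l [^] q \<otimes> a [^] (c * q)"
      using lcar ac by (simp add: lc nat_pow_distrib nat_pow_pow)
    finally have "a [^] (c * q) = inv (l [^] q)"
      using lcar ac by (intro inv_equality[symmetric]) (auto simp: m_comm)
    then have "a [^] (c * q) \<in> L"
      using subgroup_nat_pow_closed[OF Ls lc(1)] subgroup.m_inv_closed[OF Ls] by metis
    then have "p * q dvd c * q" using La q by metis
    then have "p dvd c" using npos q by auto
    then obtain d where d: "c = d * p" by (metis dvdE mult.commute)
    define z where "z = y \<otimes> inv (a [^] d)"
    have zK: "z \<in> K" unfolding z_def
      using K yK a by (auto intro: subgroup.m_closed subgroup.m_inv_closed subgroup_nat_pow_closed)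
    then have zc: "z \<in> carrier G" using Kc by auto
    have yz: "y = z \<otimes> a [^] d" unfolding z_def using yc ac by (simp add: m_assoc)
    have "z [^] p \<otimes> a [^] c = l \<otimes> a [^] c"
      using zc ac lc(2) yz d by (simp add: nat_pow_distrib nat_pow_pow)
    then have zp: "z [^] p = l" using zc ac lcar by simp
    have zM: "z \<notin> ?M"
      using yM yz aM[of d] M by (metis subgroup.m_closed)
    let ?L' = "L <#> generate G {z}"
    have "?L' \<noteq> L"
    proof -
      have "z \<in> ?L'" using mem_prod[OF zc, of z] zc Ls subgroup.one_closed[OF Ls]
        by (metis l_one nat_pow_eone)
      then show ?thesis using zM LM by auto
    qed
    moreover have "L \<subseteq> ?L'"
      using mem_prod[OF zc] Ls subgroup.subset[OF Ls] by (metis nat_pow_0 r_one subsetD subsetI)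
    ultimately have "?L' \<notin> \<L>" using Lmax by blast
    moreover have "?L' \<subseteq> K"
      using mem_prod[OF zc] LK zK K by (auto intro!: subgroup.m_closed subgroup_nat_pow_closed)
    ultimately obtain i :: nat where i: "a [^] i \<in> ?L'" "\<not> ?n dvd i"
      unfolding \<L>_def using prod[OF zc] by auto
    obtain l' j' where l': "l' \<in> L" "a [^] i = l' \<otimes> z [^] (j'::nat)"
      using i(1) mem_prod[OF zc] by blast
    have l'c: "l' \<in> carrier G" using l' LK Kc by auto
    have "p dvd j'"
    proof (rule ccontr)
      assume "\<not> p dvd j'"
      then have cop: "coprime p j'" using p(1) by (simp add: prime_imp_coprime)
      have "z [^] j' = inv l' \<otimes> a [^] i" using l' l'c zc by (simp flip: m_assoc)
      also have "\<dots> \<in> ?M" using l'(1) LM aM M by (auto intro: subgroup.m_closed subgroup.m_inv_closed)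
      finally have "z \<in> ?M"
        using p1 zp lc(1) LM by (intro mem_subgroup_if_coprime_powers[OF M zc cop]) auto
      then show False using zM by simp
    qed
    then obtain j'' where "j' = p * j''" by (auto elim: dvdE)
    then have "z [^] j' = l [^] j''" using zp zc by (simp flip: nat_pow_pow)
    then have "a [^] i \<in> L"
      using l' lc(1) Ls by (auto intro: subgroup.m_closed subgroup_nat_pow_closed)
    then show False using La i(2) by blast
  qed
  then show ?thesis using that[OF Ls LK La] mem_prod[OF ac] by blast
qed

text \<open>
  Split off a cyclic summand of maximal order and apply induction to the complement. The new generator
  comes last; every earlier order divides its order, which is the exponent.
\<close>

lemma exists_independent_generators:
  assumes fin: "finite (carrier G)" and K: "subgroup K G"
  shows "\<exists>ns e. (\<forall>n\<in>set ns. 1 < n) \<and> (\<forall>i. Suc i < length ns \<longrightarrow> ns ! i dvd ns ! Suc i) \<and>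
    (\<forall>i<length ns. e i \<in> K \<and> e i [^] (ns ! i) = \<one>) \<and>
    (\<forall>x :: nat \<Rightarrow> nat. (\<Otimes>i\<in>{..<length ns}. e i [^] x i) = \<one> \<longrightarrow> (\<forall>i<length ns. ns ! i dvd x i)) \<and>
    (\<forall>y\<in>K. \<exists>x :: nat \<Rightarrow> nat. y = (\<Otimes>i\<in>{..<length ns}. e i [^] x i))"
  using K
proof (induction "card K" arbitrary: K rule: less_induct)
  case less
  have Kc: "K \<subseteq> carrier G" by (rule subgroup.subset[OF less.prems])
  obtain a where a: "a \<in> K" and exp: "\<And>x. x \<in> K \<Longrightarrow> x [^] ord a = \<one>"
    using exists_exponent_element[OF fin less.prems] by blast
  have ac: "a \<in> carrier G" using a Kc by auto
  show ?case
  proof (cases "ord a = 1")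
    case True
    then have "y = \<one>" if "y \<in> K" for y using exp[OF that] that Kc by auto
    then show ?thesis by (intro exI[of _ "[]"]) auto
  next
    case False
    then have n: "1 < ord a" using ord_ge_1[OF fin ac] by simp
    obtain L where L: "subgroup L G" "L \<subseteq> K" and La: "\<And>k::nat. a [^] k \<in> L \<Longrightarrow> ord a dvd k"
      and LK: "\<And>x. x \<in> K \<Longrightarrow> \<exists>l\<in>L. \<exists>k::nat. x = l \<otimes> a [^] k"
      using exists_complement[OF fin less.prems a exp] by blast
    have Lc: "L \<subseteq> carrier G" using L Kc by auto
    have "a \<notin> L" using La[of 1] ac False by auto
    then have "card L < card K" using a L(2) finite_subset[OF Kc fin] by (auto intro: psubset_card_mono)
    from less.hyps[OF this L(1)] obtain ns e where
      ns: "\<forall>n\<in>set ns. 1 < n" "\<forall>i. Suc i < length ns \<longrightarrow> ns ! i dvd ns ! Suc i" and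
      e: "\<forall>i<length ns. e i \<in> L \<and> e i [^] (ns ! i) = \<one>" and
      indep: "\<And>x :: nat \<Rightarrow> nat. (\<Otimes>i\<in>{..<length ns}. e i [^] x i) = \<one> \<Longrightarrow> \<forall>i<length ns. ns ! i dvd x i" and
      span: "\<forall>y\<in>L. \<exists>x :: nat \<Rightarrow> nat. y = (\<Otimes>i\<in>{..<length ns}. e i [^] x i)"
      by blast
    let ?r = "length ns"
    define e' where "e' = e(?r := a)"
    have ec: "e i \<in> carrier G" if "i < ?r" for i using e that Lc by auto
    have prod: "(\<Otimes>i\<in>{..<?r}. e i [^] x i) \<in> L" for x :: "nat \<Rightarrow> nat"
    proof -
      have "(\<Otimes>i\<in>A. e i [^] x i) \<in> L" if "A \<subseteq> {..<?r}" for A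
        using finite_subset[OF that finite_lessThan] that
      proof (induction A rule: finite_induct)
        case empty
        then show ?case using L(1) by (simp add: subgroup.one_closed)
      next
        case (insert i A)
        then have "(\<Otimes>i\<in>insert i A. e i [^] x i) = e i [^] x i \<otimes> (\<Otimes>i\<in>A. e i [^] x i)"
          using ec by (intro finprod_insert) auto
        then show ?case using insert e L(1)
          by (auto intro!: subgroup.m_closed subgroup_nat_pow_closed)
      qed
      then show ?thesis by simp
    qed
    have ext: "(\<Otimes>i\<in>{..<Suc ?r}. e' i [^] x i) = (\<Otimes>i\<in>{..<?r}. e i [^] x i) \<otimes> a [^] x ?r"
      for x :: "nat \<Rightarrow> nat"
    proof -
      have "(\<Otimes>i\<in>{..<Suc ?r}. e' i [^] x i) = a [^] x ?r \<otimes> (\<Otimes>i\<in>{..<?r}. e' i [^] x i)"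
        unfolding lessThan_Suc using ec ac by (subst finprod_insert) (auto simp: e'_def)
      also have "(\<Otimes>i\<in>{..<?r}. e' i [^] x i) = (\<Otimes>i\<in>{..<?r}. e i [^] x i)"
        by (rule finprod_cong) (use ec in \<open>auto simp: e'_def simp_implies_def\<close>)
      finally show ?thesis using ac ec by (simp add: m_comm)
    qed
    have dvd: "ns ! i dvd ord a" if i: "i < ?r" for i
    proof -
      have "e i [^] ord a = \<one>" using exp e i L(2) by auto
      then have "(\<Otimes>j\<in>{..<?r}. e j [^] (if j = i then ord a else 0)) = \<one>"
        by (intro finprod_one_eqI) auto
      then show ?thesis using indep[of "\<lambda>j. if j = i then ord a else 0"] i by auto
    qed
    show ?thesis
    proof (intro exI[of _ "ns @ [ord a]"] exI[of _ e'] conjI)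
      show "\<forall>k\<in>set (ns @ [ord a]). 1 < k" using ns n by auto
      show "\<forall>i. Suc i < length (ns @ [ord a]) \<longrightarrow> (ns @ [ord a]) ! i dvd (ns @ [ord a]) ! Suc i"
        using ns dvd by (auto simp: nth_append less_Suc_eq)
      show "\<forall>i<length (ns @ [ord a]). e' i \<in> K \<and> e' i [^] ((ns @ [ord a]) ! i) = \<one>"
        using e L(2) a exp by (auto simp: e'_def nth_append less_Suc_eq)
      show "\<forall>x :: nat \<Rightarrow> nat. (\<Otimes>i\<in>{..<length (ns @ [ord a])}. e' i [^] x i) = \<one> \<longrightarrow>
        (\<forall>i<length (ns @ [ord a]). (ns @ [ord a]) ! i dvd x i)"
      proof (intro allI impI)
        fix x :: "nat \<Rightarrow> nat" and i
        assume "(\<Otimes>i\<in>{..<length (ns @ [ord a])}. e' i [^] x i) = \<one>" and i: "i < length (ns @ [ord a])"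
        then have eq: "(\<Otimes>i\<in>{..<?r}. e i [^] x i) \<otimes> a [^] x ?r = \<one>" using ext by simp
        let ?l = "\<Otimes>i\<in>{..<?r}. e i [^] x i"
        have lL: "?l \<in> L" "?l \<in> carrier G" using prod Lc by auto
        have "a [^] x ?r = inv ?l" using eq lL ac by (metis inv_equality m_comm nat_pow_closed)
        then have "a [^] x ?r \<in> L" using lL(1) L(1) by (simp add: subgroup.m_inv_closed)
        then have ar: "ord a dvd x ?r" by (rule La)
        then have "a [^] x ?r = \<one>" using ac by (simp add: pow_eq_id)
        then have "?l = \<one>" using eq lL by simp
        then have "\<forall>i<?r. ns ! i dvd x i" by (rule indep)
        then show "(ns @ [ord a]) ! i dvd x i" using ar i by (auto simp: nth_append less_Suc_eq)
      qed
      show "\<forall>y\<in>K. \<exists>x :: nat \<Rightarrow> nat. y = (\<Otimes>i\<in>{..<length (ns @ [ord a])}. e' i [^] x i)"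
      proof
        fix y assume "y \<in> K"
        then obtain l and k :: nat where l: "l \<in> L" "y = l \<otimes> a [^] k" using LK by blast
        then obtain x :: "nat \<Rightarrow> nat" where x: "l = (\<Otimes>i\<in>{..<?r}. e i [^] x i)" using span by blast
        have "(\<Otimes>i\<in>{..<?r}. e i [^] x i) = (\<Otimes>i\<in>{..<?r}. e i [^] (x(?r := k)) i)"
          by (rule finprod_cong) (use ec in \<open>auto simp: simp_implies_def\<close>)
        then have "y = (\<Otimes>i\<in>{..<Suc ?r}. e' i [^] (x(?r := k)) i)"
          using ext[of "x(?r := k)"] l x by simp
        then show "\<exists>x :: nat \<Rightarrow> nat. y = (\<Otimes>i\<in>{..<length (ns @ [ord a])}. e' i [^] x i)"
          by auto
      qed
    qed
  qed
qed

lemma exists_invariant_factors: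
  assumes fin: "finite (carrier G)"
  shows "\<exists>ns. is_invariant_factors G ns"
proof -
  obtain ns e where
    ns: "\<forall>n\<in>set ns. 1 < n" "\<forall>i. Suc i < length ns \<longrightarrow> ns ! i dvd ns ! Suc i" and
    e: "\<And>i. i < length ns \<Longrightarrow> e i \<in> carrier G" "\<And>i. i < length ns \<Longrightarrow> e i [^] (ns ! i) = \<one>" and
    indep: "\<And>x :: nat \<Rightarrow> nat. (\<Otimes>i\<in>{..<length ns}. e i [^] x i) = \<one> \<Longrightarrow> \<forall>i<length ns. ns ! i dvd x i" and
    span: "\<And>y. y \<in> carrier G \<Longrightarrow> \<exists>x :: nat \<Rightarrow> nat. y = (\<Otimes>i\<in>{..<length ns}. e i [^] x i)"
    using exists_independent_generators[OF fin subgroup_self] by blast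
  let ?r = "length ns"
  let ?P = "product_group {..<?r} (\<lambda>i. integer_mod_group (ns ! i))"
  have n: "1 < ns ! i" if "i < ?r" for i using ns(1) that by auto
  have n0: "0 < ns ! i" if "i < ?r" for i using n[OF that] by simp
  have carP: "carrier ?P = (\<Pi>\<^sub>E i\<in>{..<?r}. {0..<int (ns ! i)})"
    unfolding carrier_product_group
    by (rule PiE_cong) (use n in \<open>fastforce simp: carrier_integer_mod_group\<close>)
  define \<phi> where "\<phi> x = (\<Otimes>i\<in>{..<?r}. e i [^] nat (x i))" for x :: "nat \<Rightarrow> int"
  have pow_mod: "e i [^] (k mod ns ! i) = e i [^] k" if "i < ?r" for i and k :: nat
  proof -
    have "e i [^] k = e i [^] (ns ! i * (k div ns ! i) + k mod ns ! i)" by simp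
    also have "\<dots> = (e i [^] (ns ! i)) [^] (k div ns ! i) \<otimes> e i [^] (k mod ns ! i)"
      using e(1)[OF that] by (simp only: nat_pow_mult nat_pow_pow nat_pow_closed)
    finally show ?thesis using e[OF that] by simp
  qed
  have hom: "\<phi> \<in> hom ?P G"
  proof (rule homI)
    fix x y assume xy: "x \<in> carrier ?P" "y \<in> carrier ?P"
    have "\<phi> (x \<otimes>\<^bsub>?P\<^esub> y) = (\<Otimes>i\<in>{..<?r}. e i [^] nat (x i) \<otimes> e i [^] nat (y i))"
      unfolding \<phi>_def
    proof (rule finprod_cong', goal_cases)
      case (3 i)
      then have i: "i < ?r" by simp
      have "x i \<ge> 0" "y i \<ge> 0" using xy i unfolding carP by (auto simp: PiE_iff)
      then have "nat ((x i + y i) mod int (ns ! i)) = (nat (x i) + nat (y i)) mod ns ! i"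
        by (simp add: nat_mod_distrib nat_add_distrib)
      then show "e i [^] nat ((x \<otimes>\<^bsub>?P\<^esub> y) i) = e i [^] nat (x i) \<otimes> e i [^] nat (y i)"
        using i e(1)[OF i] pow_mod[OF i] by (simp add: nat_pow_mult)
    qed (use e(1) in auto)
    also have "\<dots> = \<phi> x \<otimes> \<phi> y"
      unfolding \<phi>_def using e(1) by (intro finprod_multf) auto
    finally show "\<phi> (x \<otimes>\<^bsub>?P\<^esub> y) = \<phi> x \<otimes> \<phi> y" .
  qed (use e(1) in \<open>auto simp: \<phi>_def intro!: finprod_closed\<close>)
  have gP: "group ?P" by simp
  interpret gh: group_hom ?P G \<phi>
    using hom gP by (simp add: group_hom_def group_hom_axioms_def is_group)
  have "inj_on \<phi> (carrier ?P)"
  proof (unfold gh.inj_on_one_iff, intro allI impI)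
    fix x assume x: "x \<in> carrier ?P" "\<phi> x = \<one>"
    have "x i = 0" if i: "i < ?r" for i
    proof -
      have "ns ! i dvd nat (x i)" using indep[of "\<lambda>i. nat (x i)"] x(2) i unfolding \<phi>_def by simp
      moreover have "0 \<le> x i" "x i < int (ns ! i)" using x(1) i unfolding carP by (auto simp: PiE_iff)
      ultimately show ?thesis by (auto dest: dvd_imp_le)
    qed
    then show "x = \<one>\<^bsub>?P\<^esub>"
      using x(1) unfolding carP by (auto simp: PiE_iff extensional_def fun_eq_iff restrict_def)
  qed
  moreover have "\<phi> ` carrier ?P = carrier G"
  proof
    show "carrier G \<subseteq> \<phi> ` carrier ?P"
    proof
      fix y assume "y \<in> carrier G"
      then obtain x :: "nat \<Rightarrow> nat" where x: "y = (\<Otimes>i\<in>{..<?r}. e i [^] x i)" using span by blast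
      let ?x = "\<lambda>i\<in>{..<?r}. int (x i mod ns ! i)"
      have "?x \<in> carrier ?P" unfolding carP using n0 by auto
      moreover have "\<phi> ?x = y"
        unfolding \<phi>_def x by (rule finprod_cong) (use e(1) pow_mod in \<open>auto simp: simp_implies_def\<close>)
      ultimately show "y \<in> \<phi> ` carrier ?P" by blast
    qed
  qed (use hom in \<open>auto simp: hom_def\<close>)
  ultimately have "\<phi> \<in> iso ?P G" using hom by (simp add: iso_def bij_betw_def)
  then have "G \<cong> ?P" using gP group.iso_sym is_isoI by blast
  then show ?thesis unfolding is_invariant_factors_def using ns by blast
qed

end

section \<open>From invariant factors to a tower\<close>

context comm_group
begin

text \<open>
  Level \<open>t\<close> consists of the elements whose coordinates vanish except possibly the last \<open>t\<close> ones.
\<close>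

lemma split_tower_of_invariant_factors:
  assumes "is_invariant_factors G ns"
  obtains H b where "split_tower G (length ns) (\<lambda>t. ns ! (length ns - Suc t)) H b"
proof -
  let ?r = "length ns"
  let ?P = "product_group {..<?r} (\<lambda>i. integer_mod_group (ns ! i))"
  have n: "1 < ns ! i" if "i < ?r" for i
    using assms that unfolding is_invariant_factors_def by auto
  have n0: "0 < ns ! i" if "i < ?r" for i using n[OF that] by simp
  have chain: "ns ! i dvd ns ! Suc i" if "Suc i < ?r" for i
    using assms that unfolding is_invariant_factors_def by auto
  have carP: "carrier ?P = (\<Pi>\<^sub>E i\<in>{..<?r}. {0..<int (ns ! i)})"
    unfolding carrier_product_group
    by (rule PiE_cong) (use n in \<open>fastforce simp: carrier_integer_mod_group\<close>)
  obtain \<phi> where iso: "\<phi> \<in> iso G ?P"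
    using assms unfolding is_invariant_factors_def is_iso_def by blast
  then have hom: "\<phi> \<in> hom G ?P" and inj: "inj_on \<phi> (carrier G)" and img: "\<phi> ` carrier G = carrier ?P"
    by (auto simp: iso_def bij_betw_def)
  have mem: "\<phi> x \<in> carrier ?P" if "x \<in> carrier G" for x using img that by blast
  have range: "0 \<le> \<phi> x i" "\<phi> x i < int (ns ! i)" if "x \<in> carrier G" "i < ?r" for x i
    using mem[OF that(1)] that(2) unfolding carP by (auto simp: PiE_iff)
  have mult: "\<phi> (x \<otimes> y) i = (\<phi> x i + \<phi> y i) mod int (ns ! i)"
    if "x \<in> carrier G" "y \<in> carrier G" "i < ?r" for x y i
    using hom_mult[OF hom that(1,2)] that(3) by simp
  have one: "\<phi> \<one> i = 0" if "i < ?r" for i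
  proof -
    have "\<phi> \<one> = \<one>\<^bsub>?P\<^esub>" using hom by (intro hom_one) (simp_all add: is_group)
    then show ?thesis using that by simp
  qed
  have pow: "\<phi> (x [^] k) i = (int k * \<phi> x i) mod int (ns ! i)"
    if x: "x \<in> carrier G" and i: "i < ?r" for x i and k :: nat
  proof (induction k)
    case (Suc k)
    then show ?case using x i by (simp add: mult mod_add_left_eq mod_add_right_eq algebra_simps)
  qed (use one[OF i] in simp)
  have zero: "x = \<one>" if x: "x \<in> carrier G" and "\<And>i. i < ?r \<Longrightarrow> \<phi> x i = 0" for x
  proof -
    have "\<phi> x = \<phi> \<one>"
      using mem[OF x] mem[OF one_closed] that(2) one unfolding carP
      by (intro PiE_ext) auto
    then show ?thesis using inj x by (auto dest: inj_onD)
  qed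
  define H where "H t = {x \<in> carrier G. \<forall>i<?r - t. \<phi> x i = 0}" for t
  define unit where "unit j = (\<lambda>i\<in>{..<?r}. if i = j then 1 else 0 :: int)" for j
  define b where "b t = inv_into (carrier G) \<phi> (unit (?r - Suc t))" for t
  have unit: "unit j \<in> carrier ?P" for j
    unfolding carP unit_def using n n0 by auto
  have bc: "b t \<in> carrier G" for t
    unfolding b_def using unit img by (metis inv_into_into)
  have \<phi>b: "\<phi> (b t) = unit (?r - Suc t)" for t
    unfolding b_def using unit img by (metis f_inv_into_f)
  have sg: "subgroup (H t) G" for t
  proof (rule subgroupI)
    show "H t \<subseteq> carrier G" "H t \<noteq> {}" using one unfolding H_def by auto
    show "inv x \<in> H t" if "x \<in> H t" for x
    proof -
      have x: "x \<in> carrier G" using that by (simp add: H_def)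
      have "\<phi> (inv x) i = 0" if i: "i < ?r" "\<phi> x i = 0" for i
        using mult[of x "inv x" i] x i one[of i] range[of "inv x" i] by simp
      then show ?thesis using that unfolding H_def by auto
    qed
    show "x \<otimes> y \<in> H t" if "x \<in> H t" "y \<in> H t" for x y
      using that mult unfolding H_def by auto
  qed
  have "split_tower G ?r (\<lambda>t. ns ! (?r - Suc t)) H b"
  proof (intro split_tower.intro split_tower_axioms.intro)
    show "H 0 = {\<one>}" using zero one unfolding H_def by auto
    show "H ?r = carrier G" unfolding H_def by auto
    fix t assume t: "t < ?r"
    let ?j = "?r - Suc t"
    have j: "?j < ?r" "?r - t = Suc ?j" using t by auto
    show "H t \<subseteq> H (Suc t)" unfolding H_def by auto
    show "b t \<in> H (Suc t)" unfolding H_def using bc \<phi>b by (auto simp: unit_def)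
    show bp: "b t [^] (ns ! ?j) = \<one>"
      by (rule zero) (use bc in \<open>auto simp: pow \<phi>b unit_def\<close>)
    show "1 < ns ! ?j" using n j by simp
    show "ns ! ?j dvd k" if "b t [^] (k::nat) \<in> H t" for k
    proof -
      have "\<phi> (b t [^] k) ?j = 0" using that j unfolding H_def by auto
      then have "int (ns ! ?j) dvd int k" using pow[OF bc j(1)] j by (auto simp: \<phi>b unit_def)
      then show ?thesis by simp
    qed
    show "\<exists>y\<in>H t. \<exists>k::nat. x = y \<otimes> b t [^] k" if x: "x \<in> H (Suc t)" for x
    proof -
      have xc: "x \<in> carrier G" using x by (simp add: H_def)
      define k where "k = nat (\<phi> x ?j)"
      have k: "int k = \<phi> x ?j" "k < ns ! ?j" using range[OF xc j(1)] by (auto simp: k_def)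
      let ?y = "x \<otimes> b t [^] (ns ! ?j - k)"
      have "\<phi> ?y i = 0" if i: "i < ?r - t" for i
      proof (cases "i = ?j")
        case True
        have "\<phi> ?y ?j = (int k + int (ns ! ?j - k) mod int (ns ! ?j)) mod int (ns ! ?j)"
          using mult[OF xc nat_pow_closed[OF bc] j(1)] pow[OF bc j(1)] j(1) k(1)
          by (simp add: \<phi>b unit_def)
        also have "\<dots> = 0" using k(2) by (simp add: mod_add_right_eq)
        finally show ?thesis using True by simp
      next
        case False
        then have "i < ?r - Suc t" "i < ?r" using i by auto
        then show ?thesis
          using mult[OF xc nat_pow_closed[OF bc]] pow[OF bc] x False by (simp add: H_def \<phi>b unit_def)
      qed
      then have "?y \<in> H t" using xc bc by (simp add: H_def)
      moreover have "?y \<otimes> b t [^] k = x"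
        using xc bc k(2) bp by (simp add: m_assoc nat_pow_mult)
      ultimately show ?thesis by metis
    qed
  next
    fix t assume t: "Suc t < ?r"
    then show "ns ! (?r - Suc (Suc t)) dvd ns ! (?r - Suc t)"
      using chain[of "?r - Suc (Suc t)"] by (simp add: Suc_diff_Suc)
  qed (rule comm_group_axioms, rule sg)
  then show ?thesis by (rule that)
qed

text \<open>
  No element occurs more often than \<open>order G\<close> times, since that many copies of it already have sum zero.
\<close>

lemma finite_minimal_zero_sum_sizes:
  assumes fin: "finite (carrier G)"
  shows "finite {size S |S. minimal_zero_sum G S}"
proof -
  have "size S \<le> order G * order G" if S: "minimal_zero_sum G S" for S
  proof -
    have Sc: "set_mset S \<subseteq> carrier G" using S by (simp add: minimal_zero_sum_def)
    have "count S g \<le> order G" if g: "g \<in># S" for g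
    proof (rule ccontr)
      assume large: "\<not> count S g \<le> order G"
      let ?T = "replicate_mset (order G) g"
      have gc: "g \<in> carrier G" using g Sc by auto
      have o: "0 < order G" using fin by (simp add: order_gt_0_iff_finite)
      have "?T \<subseteq># S" using large by (simp add: count_le_replicate_mset_subset_eq[symmetric])
      moreover have "seq_sum G ?T = \<one>" using gc by (simp add: seq_sum_replicate pow_order_eq_1)
      ultimately have "?T = S" using o by (intro minimal_zero_sum_subseteq[OF S]) auto
      then show False using large by (metis count_replicate_mset order_refl)
    qed
    then have "size S \<le> (\<Sum>g\<in>set_mset S. order G)"
      unfolding size_multiset_overloaded_eq by (intro sum_mono) auto
    also have "\<dots> \<le> order G * order G"
      using card_mono[OF fin Sc] by (simp add: order_def)
    finally show ?thesis .
  qed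
  then have "{size S |S. minimal_zero_sum G S} \<subseteq> {..order G * order G}" by auto
  then show ?thesis by (rule finite_subset) simp
qed

end

section \<open>The strong Davenport constants\<close>

theorem corollary5p5:
  fixes G :: "('a, 'b) monoid_scheme" and k :: nat
  assumes "comm_group G" and "finite (carrier G)"
    and "is_p_group G \<or> davenport G = Dstar G"
    and "int (group_rank G) \<ge> int (group_exp G) + 1 - int k"
  shows "strong_davenport k G = Dstar G"
proof -
  interpret comm_group G by fact
  define ns where "ns = invariant_factors G"
  define r where "r = length ns"
  define m where "m = (\<lambda>t. ns ! (r - Suc t))"
  have ns: "is_invariant_factors G ns"
    unfolding ns_def invariant_factors_def
    using exists_invariant_factors[OF assms(2)] by (rule someI_ex)
  obtain H b where "split_tower G r m H b"
    using split_tower_of_invariant_factors[OF ns] unfolding r_def m_def by blast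
  then interpret split_tower G r m H b .
  have Dstar: "Dstar G = 1 + (\<Sum>t<r. m t - 1)"
  proof -
    have "(\<Sum>t<r. m t - 1) = (\<Sum>i<r. ns ! i - 1)"
      unfolding m_def by (rule sum.nat_diff_reindex)
    also have "\<dots> = (\<Sum>n\<leftarrow>ns. n - 1)"
      by (simp add: sum_list_sum_nth r_def atLeast0LessThan)
    finally show ?thesis by (simp add: Dstar_def ns_def)
  qed
  have exp: "group_exp G = m 0" if "0 < r"
    using that by (auto simp: group_exp_def ns_def[symmetric] m_def r_def last_conv_nth)
  have m_dvd_0: "m t dvd m 0" if "t < r" for t
    using that
  proof (induction t)
    case (Suc t)
    then show ?case using m_dvd[of t] by (auto intro: dvd_trans)
  qed simp
  have upper: "size S \<le> Dstar G" if S: "minimal_zero_sum G S" for S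
    using assms(3)
  proof
    assume "is_p_group G"
    then obtain p c :: nat where p: "Factorial_Ring.prime p" "group_exp G = p ^ c"
      unfolding is_p_group_def by blast
    have "\<exists>c. m t = p ^ c" if "t < r" for t
      using m_dvd_0[OF that] exp that p divides_primepow_nat by (metis gr_zeroI not_less0)
    then show ?thesis using minimal_zero_sum_size_le[OF p(1) _ S] Dstar by simp
  next
    assume "davenport G = Dstar G"
    then show ?thesis
      using Max_ge[OF finite_minimal_zero_sum_sizes[OF assms(2)], of "size S"] S
      unfolding davenport_def by auto
  qed
  have lower: "\<exists>S. minimal_zero_sum G S \<and> cumulated_mult G S \<le> k \<and> size S = Dstar G"
  proof -
    have "\<exists>S. minimal_zero_sum G S \<and> size S = Dstar G \<and> size S \<le> card (set_mset S) + k"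
    proof -
      consider "r = 0" | "r = 1" | "2 \<le> r" by linarith
      then show ?thesis
      proof cases
        case 1
        then show ?thesis using minimal_zero_sum_one Dstar by (intro exI[of _ "{#\<one>\<^bsub>G\<^esub>#}"]) simp
      next
        case 2
        then have r: "0 < r" by simp
        then have "group_exp G = m 0" by (rule exp)
        then have "m 0 - 1 \<le> k" using assms(4) 2 by (simp add: group_rank_def ns_def r_def)
        then show ?thesis
          using 2 Dstar m_gt_1[OF r] by (rule_tac long_minimal_zero_sum_1[OF r]) force
      next
        case 3
        then have "group_exp G = m 0" by (intro exp) simp
        then have "m 0 + 1 - r \<le> k" using assms(4) by (simp add: group_rank_def ns_def r_def)
        then show ?thesis using long_minimal_zero_sum[OF 3 order_refl] Dstar by force
      qed
    qed
    then obtain S where S: "minimal_zero_sum G S" "size S = Dstar G" "size S \<le> card (set_mset S) + k"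
      by blast
    moreover have "cumulated_mult G S + card (set_mset S) = size S"
      using S(1) by (intro cumulated_mult_eq assms(2)) (simp add: minimal_zero_sum_def)
    ultimately show ?thesis by (intro exI[of _ S]) simp
  qed
  show ?thesis
    unfolding strong_davenport_def
  proof (rule Max_eqI)
    show "finite {size S |S. minimal_zero_sum G S \<and> cumulated_mult G S \<le> k}"
      by (rule finite_subset[of _ "{..Dstar G}"]) (use upper in auto)
    show "Dstar G \<in> {size S |S. minimal_zero_sum G S \<and> cumulated_mult G S \<le> k}"
      using lower by (metis (mono_tags, lifting) mem_Collect_eq)
  qed (use upper in auto)
qed

end
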